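(* (A) Let $\varphi$ be a state on $\mathcal P$, let $\mathcal P=\bigoplus_{n\in\mathbb N}\mathcal P_n$ be its orthogonal polynomial gradation, let $\langle\cdot,\cdot\rangle_n$ be the restriction to $\mathcal P_n$ of the pre-scalar product $\langle\cdot,\cdot\rangle$ induced by $\varphi$ on $\mathcal P$, let $X_j=a^+_j+a^0_j+a^-_j$ ($j\in D$) be the quantum decomposition of the coordinate $X_j$ with respect to $\varphi$, and let $a^+:v=\sum_{j\in D}v_je_j\in\mathbb C^d\mapsto a^+_v:=\sum_{j\in D}v_ja^+_j\in\mathcal L_a(\mathcal P,\langle\cdot,\cdot\rangle)$ be the creation map. Then the pair $$\left((\mathcal P_n,\langle\cdot,\cdot\rangle_n)_{n\in\mathbb N},\,a^+\right)$$ is a symmetric interacting Fock space on $\mathbb C^d$ with the following properties: (i) the restriction to $\mathcal P_{\mathbb R}$ of the pre-scalar product $\langle\cdot,\cdot\rangle$ is real valued, and there exists a family of gradation preserving self-adjoint operators $a^0_j:\mathcal P\cdot\Phi_0\to\mathcal P\cdot\Phi_0$ ($j\in D$) such that $$a^\varepsilon_j(\mathcal P_{\mathbb R}\cdot\Phi_0)\subseteq\mathcal P_{\mathbb R}\cdot\Phi_0\qquad\text{for all }\varepsilon\in\{+,0,-\},\ j\in D,$$ and the coordinate operators $X_j=a^+_j+a^0_j+a^-_j$ mutually commute; (ii) the vacuum vector $\Phi$ of this interacting Fock space (identified with $\Phi_0=1_{\mathcal P}\cdot\Phi_0$) is cyclic for the polynomial algebra generated by the family $X_j=a^+_j+a^0_j+a^-_j$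 ($j\in D$). (B) Conversely, let there be given a symmetric interacting Fock space $\left((\hat{\mathcal P}_n,\langle\cdot,\cdot\rangle_{IFS,n})_{n\in\mathbb N},\hat a^+\right)$ on $\mathbb C^d$ with vacuum vector $\Phi$, and a family of gradation preserving operators $\hat a^0_j$ ($j\in D$) on $\bigoplus_n\hat{\mathcal P}_n$ such that the operators $$\hat X_j:=\hat a^+_j+\hat a^0_j+(\hat a^+_j)^*\qquad(j\in D)$$ commute and, denoting by $\hat{\mathcal P}$ (resp. $\hat{\mathcal P}_{\mathbb R}$) the $*$-algebra (resp. real $*$-algebra) generated by the $\hat X_j$, the analogues of (i) and (ii) hold, namely: the pre-scalar product is real valued on $\hat{\mathcal P}_{\mathbb R}\cdot\Phi$; the $\hat a^0_j$ are self-adjoint; $\hat a^\varepsilon_j(\hat{\mathcal P}_{\mathbb R}\cdot\Phi)\subseteq\hat{\mathcal P}_{\mathbb R}\cdot\Phi$ for all $\varepsilon\in\{+,0,-\}$, $j\in D$ (where $\hat a^-_j:=(\hat a^+_j)^*$); and $\Phi$ is cyclic for $\hat{\mathcal P}$. Then there exists a unique state $\varphi$ on $\mathcal P$ characterized by the property that $$\varphi(X_1^{n_1}\cdots X_d^{n_d})=\langle\Phi,\hat X_1^{n_1}\cdots\hat X_d^{n_d}\Phi\rangle\qquad\text{for all }n_1,\dots,n_d\in\mathbb N.$$ Moreover these expectation values are real. In particular, denoting by $\left((\mathcal P_n,\langle\cdot,\cdot\rangle_n)_{n\in\mathbb N},a^+\right)$ the symmetric interacting Fock space associated to this $\varphi$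 as in (A), there is an isomorphism of symmetric interacting Fock spaces $$U:\left((\mathcal P_n,\langle\cdot,\cdot\rangle_n)_{n\in\mathbb N},a^+\right)\to\left((\hat{\mathcal P}_n,\langle\cdot,\cdot\rangle_{IFS,n})_{n\in\mathbb N},\hat a^+\right)$$ preserving the real structures of both spaces and such that $$X_j=U^*\hat a^+_jU+U^*\hat a^0_jU+(U^*\hat a^+_jU)^*$$ is the quantum decomposition of $X_j$ with respect to $\varphi$, for every $j\in D$.
   Context: $\mathbb N=\{0,1,2,\dots\}$, $d\ge1$, $D=\{1,\dots,d\}$, $(e_j)_{j\in D}$ the canonical basis of $\mathbb C^d$. $\mathcal P=\mathbb C[X_1,\dots,X_d]$ is the complex polynomial $*$-algebra in commuting indeterminates with $X_j^*=X_j$; $\mathcal P_{\mathbb R}$ is the set of real polynomials; $X_j$ also denotes multiplication by $X_j$ on $\mathcal P$. $Q\cdot\Phi_0$ denotes $Q\in\mathcal P$ regarded as a vector ($\Phi_0=1_{\mathcal P}$). $\mathcal P_{n]}$ is the space of polynomials of degree $\le n$. A state on $\mathcal P$ is a linear functional $\varphi$, real on real polynomials, with $\varphi(1_{\mathcal P})=1$ and $\varphi(Q^*Q)\ge0$; it induces the pre-scalar product $\langle a,b\rangle=\varphi(a^*b)$. Pre-Hilbert conventions. A pre-scalar product is a positive, possibly degenerate, Hermitian form; zero-norm vectors are those with $\langle\xi,\xi\rangle=0$. $\mathcal L_a(H,K)$ is the set of everywhere defined linear $A:H\to K$ mapping zero-norm vectors to zero-norm vectors and having an everywhere defined adjoint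 $A^*:K\to H$; $\mathcal L_a(H)=\mathcal L_a(H,H)$. Adjoints are determined only up to operators with range in the zero-norm vectors; a choice is fixed, $A$ is self-adjoint if $A=A^*$ for some choice, and identities obtained by taking adjoints are understood modulo operators with range in the zero-norm vectors. All direct sums are algebraic. Orthogonal polynomial gradation of $\varphi$. Inductively: $\mathcal P_0=\mathbb C1_{\mathcal P}$, $P_0(Q)=\varphi(Q)1_{\mathcal P}$. Given self-adjoint projections $P_0,\dots,P_n$ mapping real polynomials to real polynomials, with $P_{n]}:=P_0+\dots+P_n$ projecting $\mathcal P$ onto $\mathcal P_{n]}$, let $\mathcal P_{n+1}$ be the linear span of $\{M-P_{n]}(M): M\text{ a monomial of degree }n+1\}$, and let $P_{n+1}$ be a (chosen) self-adjoint projection of $\mathcal P$ onto $\mathcal P_{n+1}$, mapping real polynomials to real polynomials and satisfying $P_{n+1}P_k=P_kP_{n+1}=0$ for $k\le n$. Then $\mathcal P=\bigoplus_n\mathcal P_n$ orthogonally. Put $P_{-1}=0$. The quantum decomposition of $X_j$ with respect to $\varphi$ is $X_j=a^+_j+a^0_j+a^-_j$, where on each $\mathcal P_n$: $a^+_j=P_{n+1}X_jP_n$, $a^0_j=P_nX_jP_n$, $a^-_j=P_{n-1}X_jP_n$. Interacting Fock spaces. An interacting Fock space (IFS) on a vector space $V$ is a pair $\{(H_n,\langle\cdot,\cdot\rangle_n)_{n\in\mathbb N},a^+\}$ where the $H_n$ are pre-Hilbert spaces, $H_0=\mathbb C\Phi$ with $\|\Phi\|=1$ ($\Phi$ is the vacuum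 vector), and, with $H=\bigoplus_nH_n$ the orthogonal sum, $a^+:V\to\mathcal L_a(H)$ is linear, maps $H_n$ into $H_{n+1}$, and satisfies $H_{n+1}=\text{lin-span}\{a^+(V)H_n\}$ for all $n$; for each $v$ an adjoint $a(v)$ of $a^+(v)$ is fixed, with $a(v)\Phi=0$. For $V=\mathbb C^d$ write $a^+_j=a^+(e_j)$. The IFS is symmetric if the creators $a^+(v)$ ($v\in V$) commute. A morphism from an IFS $\{(H_n),a^+\}$ on $V$ to an IFS $\{(H_{1,n}),a^+_1\}$ on $V_1$ is a linear map $U_1:V\to V_1$ together with a gradation preserving linear isometry $U:\bigoplus H_n\to\bigoplus H_{1,n}$ such that $Ua^+(v)U^*=a^+_1(U_1v)$ for all $v\in V$; it is an isomorphism if $U_1$ is invertible and $U$ is onto up to zero-norm vectors. A vector $\Phi$ is cyclic for an algebra if the algebra applied to $\Phi$ gives the whole space. *)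

theory Defs
  imports "HOL-Analysis.Analysis" "HOL-Library.Poly_Mapping"
begin

section \<open>Pre-Hilbert spaces\<close>

text \<open>The carrier is the whole type. The form is antilinear in its first argument and
  possibly degenerate.\<close>

record 'h prehilb =
  scl :: "complex \<Rightarrow> 'h \<Rightarrow> 'h"
  ip :: "'h \<Rightarrow> 'h \<Rightarrow> complex"

definition pre_hilbert :: "('h::ab_group_add, 'x) prehilb_scheme \<Rightarrow> bool" where
  "pre_hilbert H \<longleftrightarrow>
     vector_space (scl H) \<and>
     (\<forall>x. Vector_Spaces.linear (scl H) (*) (ip H x)) \<and>
     (\<forall>x y. ip H y x = cnj (ip H x y)) \<and>
     (\<forall>x. ip H x x \<in> \<real>\<^sub>\<ge>\<^sub>0)"

definition null_vec :: "('h, 'x) prehilb_scheme \<Rightarrow> 'h \<Rightarrow> bool" where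
  "null_vec H x \<longleftrightarrow> ip H x x = 0"

definition eq_mod_null :: "('k::ab_group_add, 'y) prehilb_scheme \<Rightarrow> ('h \<Rightarrow> 'k) \<Rightarrow> ('h \<Rightarrow> 'k) \<Rightarrow> bool" where
  "eq_mod_null K A B \<longleftrightarrow> (\<forall>x. null_vec K (A x - B x))"

text \<open>\<open>B\<close> is one of the possible choices of the adjoint of \<open>A\<close>; these differ by
  operators whose range consists of zero-norm vectors.\<close>

definition is_adjoint ::
  "('h::ab_group_add, 'x) prehilb_scheme \<Rightarrow> ('k::ab_group_add, 'y) prehilb_scheme
     \<Rightarrow> ('h \<Rightarrow> 'k) \<Rightarrow> ('k \<Rightarrow> 'h) \<Rightarrow> bool" where
  "is_adjoint H K A B \<longleftrightarrow>
     Vector_Spaces.linear (scl H) (scl K) A \<and>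
     Vector_Spaces.linear (scl K) (scl H) B \<and>
     (\<forall>x y. ip K (A x) y = ip H x (B y))"

definition adjointable ::
  "('h::ab_group_add, 'x) prehilb_scheme \<Rightarrow> ('k::ab_group_add, 'y) prehilb_scheme
     \<Rightarrow> ('h \<Rightarrow> 'k) set" where
  "adjointable H K = {A. Vector_Spaces.linear (scl H) (scl K) A \<and>
     (\<forall>x. null_vec H x \<longrightarrow> null_vec K (A x)) \<and> (\<exists>B. is_adjoint H K A B)}"

abbreviation self_adjoint :: "('h::ab_group_add, 'x) prehilb_scheme \<Rightarrow> ('h \<Rightarrow> 'h) \<Rightarrow> bool" where
  "self_adjoint H A \<equiv> is_adjoint H H A A"

definition direct_sum :: "(complex \<Rightarrow> 'h::ab_group_add \<Rightarrow> 'h) \<Rightarrow> (nat \<Rightarrow> 'h set) \<Rightarrow> bool" where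
  "direct_sum s G \<longleftrightarrow>
     (\<forall>n. module.subspace s (G n)) \<and>
     (\<forall>x. \<exists>!f. (\<forall>n. f n \<in> G n) \<and> finite {n. f n \<noteq> 0} \<and> x = (\<Sum>n | f n \<noteq> 0. f n))"

text \<open>The unital algebra of operators generated by \<open>G\<close>, with scalars from \<open>K\<close>. It is used
  only for \<open>G\<close> a family of self-adjoint operators, where the real (resp. complex) algebra
  generated by \<open>G\<close> is also the real (resp. complex) \<open>*\<close>-algebra generated by \<open>G\<close>.\<close>

inductive_set op_algebra ::
  "(complex \<Rightarrow> 'h::ab_group_add \<Rightarrow> 'h) \<Rightarrow> complex set \<Rightarrow> ('h \<Rightarrow> 'h) set \<Rightarrow> ('h \<Rightarrow> 'h) set"
  for s :: "complex \<Rightarrow> 'h::ab_group_add \<Rightarrow> 'h" and K :: "complex set" and G :: "('h \<Rightarrow> 'h) set"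
where
  one: "id \<in> op_algebra s K G"
| gen: "A \<in> G \<Longrightarrow> A \<in> op_algebra s K G"
| add: "A \<in> op_algebra s K G \<Longrightarrow> B \<in> op_algebra s K G \<Longrightarrow> (\<lambda>x. A x + B x) \<in> op_algebra s K G"
| scale: "c \<in> K \<Longrightarrow> A \<in> op_algebra s K G \<Longrightarrow> (\<lambda>x. s c (A x)) \<in> op_algebra s K G"
| comp: "A \<in> op_algebra s K G \<Longrightarrow> B \<in> op_algebra s K G \<Longrightarrow> A \<circ> B \<in> op_algebra s K G"

section \<open>Interacting Fock spaces\<close>

text \<open>The pre-Hilbert space is the whole sum \<open>H\<close>, graded by the subspaces \<open>grade n\<close>; the forms
  of the homogeneous components are the restrictions of \<open>ip\<close>. The field \<open>ann v\<close> is the fixed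
  adjoint of the creator \<open>cre v\<close>.\<close>

record ('v, 'h) ifs = "'h prehilb" +
  grade :: "nat \<Rightarrow> 'h set"
  vac :: 'h
  cre :: "'v \<Rightarrow> 'h \<Rightarrow> 'h"
  ann :: "'v \<Rightarrow> 'h \<Rightarrow> 'h"

definition is_ifs ::
  "(complex \<Rightarrow> 'v::ab_group_add \<Rightarrow> 'v) \<Rightarrow> ('v, 'h::ab_group_add) ifs \<Rightarrow> bool" where
  "is_ifs sV F \<longleftrightarrow>
     vector_space sV \<and>
     pre_hilbert F \<and>
     direct_sum (scl F) (grade F) \<and>
     (\<forall>m n x y. m \<noteq> n \<longrightarrow> x \<in> grade F m \<longrightarrow> y \<in> grade F n \<longrightarrow> ip F x y = 0) \<and>
     grade F 0 = module.span (scl F) {vac F} \<and>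
     ip F (vac F) (vac F) = 1 \<and>
     (\<forall>v. cre F v \<in> adjointable F F) \<and>
     (\<forall>u v x. cre F (u + v) x = cre F u x + cre F v x) \<and>
     (\<forall>c v x. cre F (sV c v) x = scl F c (cre F v x)) \<and>
     (\<forall>v n. cre F v ` grade F n \<subseteq> grade F (Suc n)) \<and>
     (\<forall>n. grade F (Suc n) = module.span (scl F) (\<Union>v. cre F v ` grade F n)) \<and>
     (\<forall>v. is_adjoint F F (cre F v) (ann F v) \<and> ann F v (vac F) = 0)"

definition symmetric_ifs ::
  "(complex \<Rightarrow> 'v::ab_group_add \<Rightarrow> 'v) \<Rightarrow> ('v, 'h::ab_group_add) ifs \<Rightarrow> bool" where
  "symmetric_ifs sV F \<longleftrightarrow> is_ifs sV F \<and> (\<forall>u v. cre F u \<circ> cre F v = cre F v \<circ> cre F u)"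

definition gradation_preserving :: "('v, 'h) ifs \<Rightarrow> ('h \<Rightarrow> 'h) \<Rightarrow> bool" where
  "gradation_preserving F A \<longleftrightarrow> (\<forall>n. A ` grade F n \<subseteq> grade F n)"

text \<open>\<open>Us\<close> is the fixed adjoint of \<open>U\<close>. The intertwining relation involves it and is therefore
  required modulo zero-norm vectors.\<close>

definition ifs_morphism ::
  "(complex \<Rightarrow> 'v::ab_group_add \<Rightarrow> 'v) \<Rightarrow> (complex \<Rightarrow> 'w::ab_group_add \<Rightarrow> 'w)
     \<Rightarrow> ('v, 'h::ab_group_add) ifs \<Rightarrow> ('w, 'k::ab_group_add) ifs
     \<Rightarrow> ('v \<Rightarrow> 'w) \<Rightarrow> ('h \<Rightarrow> 'k) \<Rightarrow> ('k \<Rightarrow> 'h) \<Rightarrow> bool" where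
  "ifs_morphism sV sW F F1 U1 U Us \<longleftrightarrow>
     Vector_Spaces.linear sV sW U1 \<and>
     Vector_Spaces.linear (scl F) (scl F1) U \<and>
     (\<forall>n. U ` grade F n \<subseteq> grade F1 n) \<and>
     (\<forall>x y. ip F1 (U x) (U y) = ip F x y) \<and>
     is_adjoint F F1 U Us \<and>
     (\<forall>v. eq_mod_null F1 (U \<circ> cre F v \<circ> Us) (cre F1 (U1 v)))"

definition ifs_isomorphism ::
  "(complex \<Rightarrow> 'v::ab_group_add \<Rightarrow> 'v) \<Rightarrow> (complex \<Rightarrow> 'w::ab_group_add \<Rightarrow> 'w)
     \<Rightarrow> ('v, 'h::ab_group_add) ifs \<Rightarrow> ('w, 'k::ab_group_add) ifs
     \<Rightarrow> ('v \<Rightarrow> 'w) \<Rightarrow> ('h \<Rightarrow> 'k) \<Rightarrow> ('k \<Rightarrow> 'h) \<Rightarrow> bool" where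
  "ifs_isomorphism sV sW F F1 U1 U Us \<longleftrightarrow>
     ifs_morphism sV sW F F1 U1 U Us \<and> bij U1 \<and> (\<forall>y. \<exists>x. null_vec F1 (y - U x))"

subsection \<open>Coordinate operators on an IFS on \<open>\<complex>\<^sup>d\<close>\<close>

text \<open>The index set \<open>D\<close> is a finite (nonempty) linearly ordered type \<open>'d\<close>.\<close>

abbreviation basis_vec :: "'d::finite \<Rightarrow> complex ^ 'd" where
  "basis_vec j \<equiv> axis j 1"

definition coord :: "(complex ^ 'd::finite, 'h::ab_group_add) ifs \<Rightarrow> ('d \<Rightarrow> 'h \<Rightarrow> 'h) \<Rightarrow> 'd \<Rightarrow> 'h \<Rightarrow> 'h" where
  "coord F a0 j = (\<lambda>x. cre F (basis_vec j) x + a0 j x + ann F (basis_vec j) x)"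

definition coord_commute :: "(complex ^ 'd::finite, 'h::ab_group_add) ifs \<Rightarrow> ('d \<Rightarrow> 'h \<Rightarrow> 'h) \<Rightarrow> bool" where
  "coord_commute F a0 \<longleftrightarrow>
     (\<forall>j k. eq_mod_null F (coord F a0 j \<circ> coord F a0 k) (coord F a0 k \<circ> coord F a0 j))"

definition real_vectors :: "(complex ^ 'd::finite, 'h::ab_group_add) ifs \<Rightarrow> ('d \<Rightarrow> 'h \<Rightarrow> 'h) \<Rightarrow> 'h set" where
  "real_vectors F a0 = (\<lambda>A. A (vac F)) ` op_algebra (scl F) \<real> (range (coord F a0))"

definition real_structure_cond ::
  "(complex ^ 'd::finite, 'h::ab_group_add) ifs \<Rightarrow> ('d \<Rightarrow> 'h \<Rightarrow> 'h) \<Rightarrow> 'h set \<Rightarrow> bool" where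
  "real_structure_cond F a0 R \<longleftrightarrow>
     (\<forall>x\<in>R. \<forall>y\<in>R. ip F x y \<in> \<real>) \<and>
     (\<forall>j. gradation_preserving F (a0 j) \<and> self_adjoint F (a0 j)) \<and>
     (\<forall>j. cre F (basis_vec j) ` R \<subseteq> R \<and> a0 j ` R \<subseteq> R \<and> ann F (basis_vec j) ` R \<subseteq> R) \<and>
     coord_commute F a0"

definition vacuum_cyclic :: "(complex ^ 'd::finite, 'h::ab_group_add) ifs \<Rightarrow> ('d \<Rightarrow> 'h \<Rightarrow> 'h) \<Rightarrow> bool" where
  "vacuum_cyclic F a0 \<longleftrightarrow>
     (\<lambda>A. A (vac F)) ` op_algebra (scl F) UNIV (range (coord F a0)) = UNIV"

text \<open>The ordered product \<open>X 1 ^ n 1 \<circ> \<dots> \<circ> X d ^ n d\<close>.\<close>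

definition op_monomial :: "('d::{finite,linorder} \<Rightarrow> 'h \<Rightarrow> 'h) \<Rightarrow> ('d \<Rightarrow> nat) \<Rightarrow> 'h \<Rightarrow> 'h" where
  "op_monomial X n = foldr (\<lambda>j A. (X j ^^ n j) \<circ> A) (sorted_list_of_set UNIV) id"

section \<open>Polynomials, states and the orthogonal gradation\<close>

type_synonym 'd cpoly = "('d \<Rightarrow>\<^sub>0 nat) \<Rightarrow>\<^sub>0 complex"

definition pvar :: "'d \<Rightarrow> 'd cpoly" where
  "pvar j = Poly_Mapping.single (Poly_Mapping.single j 1) 1"

definition pscale :: "complex \<Rightarrow> 'd cpoly \<Rightarrow> 'd cpoly" where
  "pscale c p = Poly_Mapping.single 0 c * p"

definition pstar :: "'d cpoly \<Rightarrow> 'd cpoly" where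
  "pstar = Poly_Mapping.map cnj"

definition real_polys :: "'d cpoly set" where
  "real_polys = {p. \<forall>m. Poly_Mapping.lookup p m \<in> \<real>}"

definition pmonomial :: "('d::finite \<Rightarrow> nat) \<Rightarrow> 'd cpoly" where
  "pmonomial n = (\<Prod>j\<in>UNIV. pvar j ^ n j)"

definition state :: "('d cpoly \<Rightarrow> complex) \<Rightarrow> bool" where
  "state \<phi> \<longleftrightarrow>
     Vector_Spaces.linear pscale (*) \<phi> \<and>
     (\<forall>p\<in>real_polys. \<phi> p \<in> \<real>) \<and>
     \<phi> 1 = 1 \<and>
     (\<forall>Q. \<phi> (pstar Q * Q) \<in> \<real>\<^sub>\<ge>\<^sub>0)"

definition state_space :: "('d cpoly \<Rightarrow> complex) \<Rightarrow> 'd cpoly prehilb" where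
  "state_space \<phi> = \<lparr>scl = pscale, ip = (\<lambda>a b. \<phi> (pstar a * b))\<rparr>"

text \<open>The space \<open>\<P>\<^sub>n\<close> determined by the projections \<open>P 0, \<dots>, P (n - 1)\<close>.\<close>

primrec ortho_space :: "(nat \<Rightarrow> 'd::finite cpoly \<Rightarrow> 'd cpoly) \<Rightarrow> nat \<Rightarrow> 'd cpoly set" where
  "ortho_space P 0 = module.span pscale {1}"
| "ortho_space P (Suc n) = module.span pscale
     {pmonomial m - (\<Sum>k\<le>n. P k (pmonomial m)) | m. (\<Sum>j\<in>UNIV. m j) = Suc n}"

text \<open>\<open>P\<close> is one of the possible choices of the projections. That \<open>P 0 + \<dots> + P n\<close> projects onto
  the polynomials of degree at most \<open>n\<close> is a consequence.\<close>

definition orthogonal_gradation ::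
  "('d::finite cpoly \<Rightarrow> complex) \<Rightarrow> (nat \<Rightarrow> 'd cpoly \<Rightarrow> 'd cpoly) \<Rightarrow> bool" where
  "orthogonal_gradation \<phi> P \<longleftrightarrow>
     P 0 = (\<lambda>Q. pscale (\<phi> Q) 1) \<and>
     (\<forall>n. self_adjoint (state_space \<phi>) (P (Suc n)) \<and>
          P (Suc n) \<circ> P (Suc n) = P (Suc n) \<and>
          range (P (Suc n)) = ortho_space P (Suc n) \<and>
          P (Suc n) ` real_polys \<subseteq> real_polys \<and>
          (\<forall>k\<le>n. P (Suc n) \<circ> P k = (\<lambda>_. 0) \<and> P k \<circ> P (Suc n) = (\<lambda>_. 0)))"

text \<open>The components of the quantum decomposition. Each polynomial has only finitely many
  nonzero components \<open>P n Q\<close>.\<close>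

definition qd_plus :: "(nat \<Rightarrow> 'd cpoly \<Rightarrow> 'd cpoly) \<Rightarrow> 'd \<Rightarrow> 'd cpoly \<Rightarrow> 'd cpoly" where
  "qd_plus P j Q = (\<Sum>n | P n Q \<noteq> 0. P (Suc n) (pvar j * P n Q))"

definition qd_zero :: "(nat \<Rightarrow> 'd cpoly \<Rightarrow> 'd cpoly) \<Rightarrow> 'd \<Rightarrow> 'd cpoly \<Rightarrow> 'd cpoly" where
  "qd_zero P j Q = (\<Sum>n | P n Q \<noteq> 0. P n (pvar j * P n Q))"

definition qd_minus :: "(nat \<Rightarrow> 'd cpoly \<Rightarrow> 'd cpoly) \<Rightarrow> 'd \<Rightarrow> 'd cpoly \<Rightarrow> 'd cpoly" where
  "qd_minus P j Q =
     (\<Sum>n | P n Q \<noteq> 0. case n of 0 \<Rightarrow> 0 | Suc k \<Rightarrow> P k (pvar j * P n Q))"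

text \<open>Since the form may be degenerate, \<open>X\<^sub>j\<close> is the sum of its three components only modulo
  operators with range in the zero-norm vectors: for \<open>k < n - 1\<close> the operator \<open>P k \<circ> X\<^sub>j \<circ> P n\<close>
  has zero-norm range, but need not vanish.\<close>

definition is_quantum_decomposition ::
  "('d::finite cpoly \<Rightarrow> complex) \<Rightarrow> (nat \<Rightarrow> 'd cpoly \<Rightarrow> 'd cpoly) \<Rightarrow> 'd
     \<Rightarrow> ('d cpoly \<Rightarrow> 'd cpoly) \<Rightarrow> ('d cpoly \<Rightarrow> 'd cpoly) \<Rightarrow> ('d cpoly \<Rightarrow> 'd cpoly) \<Rightarrow> bool" where
  "is_quantum_decomposition \<phi> P j A B C \<longleftrightarrow>
     eq_mod_null (state_space \<phi>) ((*) (pvar j)) (\<lambda>Q. A Q + B Q + C Q) \<and>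
     eq_mod_null (state_space \<phi>) A (qd_plus P j) \<and>
     eq_mod_null (state_space \<phi>) B (qd_zero P j) \<and>
     eq_mod_null (state_space \<phi>) C (qd_minus P j)"

definition poly_ifs ::
  "('d::finite cpoly \<Rightarrow> complex) \<Rightarrow> (nat \<Rightarrow> 'd cpoly \<Rightarrow> 'd cpoly) \<Rightarrow> (complex ^ 'd, 'd cpoly) ifs" where
  "poly_ifs \<phi> P = \<lparr>
     scl = pscale,
     ip = (\<lambda>a b. \<phi> (pstar a * b)),
     grade = ortho_space P,
     vac = 1,
     cre = (\<lambda>v Q. \<Sum>j\<in>UNIV. pscale (v $ j) (qd_plus P j Q)),
     ann = (\<lambda>v Q. \<Sum>j\<in>UNIV. pscale (cnj (v $ j)) (qd_minus P j Q))\<rparr>"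

end

theory Submission
  imports Defs
begin

text \<open>For (A), the projection onto the polynomials of degree at most \<open>n\<close> is extended by one monomial at a
  time. Multiplication by \<open>X\<^sub>j\<close> raises the degree by one, so \<open>P (Suc n)\<close> kills \<open>X\<^sub>j p\<close> as soon as \<open>p\<close> has degree
  below \<open>n\<close>; hence creators act on the vectors \<open>P n (mon m)\<close> by adding a unit to the exponent \<open>m\<close>, exactly
  and not only up to zero-norm vectors. The remaining components \<open>P k \<circ> X\<^sub>j \<circ> P n\<close> are controlled by the
  symmetry of \<open>X\<^sub>j\<close>.

  For (B), \<open>\<phi> p = \<langle>\<Phi>, p(Y) \<Phi>\<rangle>\<close> is a state because the coordinates \<open>Y\<^sub>j\<close> are self-adjoint and commute up to
  zero-norm vectors, and \<open>p \<mapsto> p(Y) \<Phi>\<close> is isometric. Both this map and the creators respect the filtrations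
  by degree and by number of particles, so \<open>P n (mon m)\<close> is sent to the component of \<open>Y\<^sup>m \<Phi>\<close> orthogonal to the
  lower filtration step. That component is the creator monomial with exponent \<open>m\<close>, up to a zero-norm vector.\<close>

section \<open>Linear maps and pre-Hilbert spaces\<close>

text \<open>The obstacle is the degenerate form. Some requirements are exact: the products and
  ranges of the projections, the commuting of the creators, the grading of the isomorphism. These
  are obtained algebraically, from compatible projections, degrees and exponents, since an identity
  of inner products only determines vectors up to zero norm. Whatever passes through an adjoint
  holds modulo zero-norm vectors and is proved by testing against all vectors.

  The comparison in (B) rests on one principle: a vector that lies in a filtration step and is
  orthogonal to that step has norm zero. To apply it, the filtration by number of particles must be
  contained, up to zero-norm vectors, in the filtration by degree, because orthogonality of
  \<open>P n (mon m)\<close> is available only against images of polynomials of lower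
  degree.\<close>

lemma lin_add: "Vector_Spaces.linear s t f \<Longrightarrow> f (x + y) = f x + f y"
  and lin_scale: "Vector_Spaces.linear s t f \<Longrightarrow> f (s c x) = t c (f x)"
  by (simp_all add: Vector_Spaces.linear_iff)

lemma lin_0: "Vector_Spaces.linear s t f \<Longrightarrow> f 0 = 0"
  and lin_diff: "Vector_Spaces.linear s t f \<Longrightarrow> f (x - y) = f x - f y"
  and lin_sum: "Vector_Spaces.linear s t f \<Longrightarrow> f (sum g A) = (\<Sum>a\<in>A. f (g a))"
  by (simp_all add: linear_iff_module_hom module_hom.zero module_hom.diff module_hom.sum)

lemma linear_spaces:
  assumes "Vector_Spaces.linear s t f"
  shows "vector_space s" "vector_space t"
  using assms by (simp_all add: Vector_Spaces.linear_iff)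

lemma lin_plus:
  assumes "Vector_Spaces.linear s t f" "Vector_Spaces.linear s t g"
  shows "Vector_Spaces.linear s t (\<lambda>x. f x + g x)"
  using assms by (simp add: Vector_Spaces.linear_iff vector_space.vector_space_assms(1))

lemma lin_minus:
  assumes "Vector_Spaces.linear s t f" "Vector_Spaces.linear s t g"
  shows "Vector_Spaces.linear s t (\<lambda>x. f x - g x)"
proof -
  interpret t: vector_space t using linear_spaces[OF assms(1)] by simp
  show ?thesis using assms by (simp add: Vector_Spaces.linear_iff t.scale_right_diff_distrib)
qed

lemma lin_eq_on_span:
  assumes "Vector_Spaces.linear s t f" "Vector_Spaces.linear s t g"
    and "\<And>x. x \<in> S \<Longrightarrow> f x = g x" and "x \<in> module.span s S"
  shows "f x = g x"
proof -
  interpret vector_space s using linear_spaces[OF assms(1)] by simp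
  show ?thesis
    using assms(4) by (induction rule: span_induct_alt)
      (simp_all add: lin_0[OF assms(1)] lin_0[OF assms(2)] lin_add[OF assms(1)]
        lin_add[OF assms(2)] lin_scale[OF assms(1)] lin_scale[OF assms(2)] assms(3))
qed

lemma subspace_range:
  assumes "Vector_Spaces.linear s t f"
  shows "module.subspace t (range f)"
proof -
  interpret module_hom s t f using assms by (simp add: linear_iff_module_hom)
  show ?thesis using subspace_image[OF m1.subspace_UNIV] .
qed

locale prehilbert_space =
  fixes H :: "('h::ab_group_add, 'x) prehilb_scheme"
  assumes pre_hilbert: "pre_hilbert H"
begin

sublocale vector_space "scl H"
  using pre_hilbert by (simp add: pre_hilbert_def)

lemma linear_ip: "Vector_Spaces.linear (scl H) (*) (ip H x)"
  using pre_hilbert by (simp add: pre_hilbert_def)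

lemma ip_commute: "ip H y x = cnj (ip H x y)"
  using pre_hilbert unfolding pre_hilbert_def by blast

lemmas ip_add_right = lin_add[OF linear_ip]
  and ip_scale_right = lin_scale[OF linear_ip]
  and ip_zero_right = lin_0[OF linear_ip]
  and ip_diff_right = lin_diff[OF linear_ip]
  and ip_sum_right = lin_sum[OF linear_ip]

lemma ip_add_left: "ip H (x + y) z = ip H x z + ip H y z"
  unfolding ip_commute[of "x + y" z] ip_commute[of x z] ip_commute[of y z] by (simp add: ip_add_right)

lemma ip_diff_left: "ip H (x - y) z = ip H x z - ip H y z"
  unfolding ip_commute[of "x - y" z] ip_commute[of x z] ip_commute[of y z] by (simp add: ip_diff_right)

lemma ip_scale_left: "ip H (scl H c x) z = cnj c * ip H x z"
  unfolding ip_commute[of "scl H c x" z] ip_commute[of x z] by (simp add: ip_scale_right)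

lemma ip_zero_left: "ip H 0 z = 0"
  unfolding ip_commute[of 0 z] by (simp add: ip_zero_right)

lemma ip_sum_left: "ip H (sum f A) z = (\<Sum>a\<in>A. ip H (f a) z)"
  by (induction A rule: infinite_finite_induct) (simp_all add: ip_zero_left ip_add_left)

lemmas ip_simps = ip_add_left ip_add_right ip_diff_left ip_diff_right ip_scale_left ip_scale_right
  ip_zero_left ip_zero_right

text \<open>Degenerate case of the Cauchy-Schwarz inequality. As \<open>x\<close> has norm zero, the
  squared norm of \<open>y + scl H c x\<close> is affine in \<open>c\<close>, so a nonzero linear
  coefficient would make it negative for a suitable \<open>c\<close>.\<close>

lemma null_ip_right:
  assumes "null_vec H x"
  shows "ip H y x = 0"
proof (rule ccontr)
  define a where "a = ip H y x"
  assume "ip H y x \<noteq> 0"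
  then have a: "a \<noteq> 0" by (simp add: a_def)
  define b where "b = ip H y y"
  have pos: "ip H z z \<in> \<real>\<^sub>\<ge>\<^sub>0" for z using pre_hilbert unfolding pre_hilbert_def by blast
  have bR: "b \<in> \<real>\<^sub>\<ge>\<^sub>0" using pos by (simp add: b_def)
  \<comment> \<open>Chosen so that the squared norm of \<open>y + scl H c x\<close> comes out as
    exactly \<open>-1\<close>.\<close>
  define s where "s = (Re b + 1) / (2 * (cmod a)\<^sup>2)"
  define c where "c = - (complex_of_real s * cnj a)"
  have "ip H (y + scl H c x) (y + scl H c x) = b + c * a + cnj c * cnj a"
    using assms ip_commute[of x y] by (simp add: ip_simps null_vec_def a_def b_def)
  also have "\<dots> = b - 2 * of_real s * of_real ((cmod a)\<^sup>2)"
    unfolding c_def complex_norm_square by (simp add: algebra_simps)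
  finally have "Re (ip H (y + scl H c x) (y + scl H c x)) = Re b - 2 * s * (cmod a)\<^sup>2"
    by (simp del: of_real_power)
  also have "\<dots> = -1" using a by (simp add: s_def field_simps)
  finally show False using pos[of "y + scl H c x"] by (simp add: complex_nonneg_Reals_iff)
qed

lemma null_ip_left: "null_vec H x \<Longrightarrow> ip H x y = 0"
  using null_ip_right ip_commute by (metis complex_cnj_zero)

text \<open>Turns equality modulo zero-norm vectors into equality of inner products. Transitivity
  becomes trivial, and operators can be moved across the form by their adjoints.\<close>

lemma null_diff_iff_right: "null_vec H (x - y) \<longleftrightarrow> (\<forall>z. ip H z x = ip H z y)"
  by (metis eq_iff_diff_eq_0 ip_diff_right null_ip_right null_vec_def)

lemma null_diff_iff_left: "null_vec H (x - y) \<longleftrightarrow> (\<forall>z. ip H x z = ip H y z)"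
  unfolding null_diff_iff_right by (metis ip_commute)

lemma null_diff_trans: "null_vec H (x - y) \<Longrightarrow> null_vec H (y - z) \<Longrightarrow> null_vec H (x - z)"
  and null_diff_sym: "null_vec H (x - y) \<Longrightarrow> null_vec H (y - x)"
  by (simp_all add: null_diff_iff_right)

lemma subspace_null: "subspace {x. null_vec H x}"
  by (rule subspaceI) (auto simp: null_vec_def ip_simps null_ip_right[unfolded null_vec_def])

lemma null_zero: "null_vec H 0"
  and null_add: "null_vec H x \<Longrightarrow> null_vec H y \<Longrightarrow> null_vec H (x + y)"
  and null_scale: "null_vec H x \<Longrightarrow> null_vec H (scl H c x)"
  using subspace_null subspace_0 subspace_add subspace_scale by blast+

lemma is_adjoint_sym:
  assumes "is_adjoint H H A B"
  shows "is_adjoint H H B A"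
  using assms unfolding is_adjoint_def by (metis ip_commute)

text \<open>The squared norm of \<open>A x\<close> equals \<open>ip H x (B (A x))\<close>, which
  vanishes for a zero-norm \<open>x\<close>.\<close>

lemma is_adjoint_null:
  assumes "is_adjoint H H A B" "null_vec H x"
  shows "null_vec H (A x)"
  using assms null_ip_left unfolding is_adjoint_def null_vec_def by metis

lemma is_adjoint_null_diff:
  assumes "is_adjoint H H A B" "null_vec H (x - y)"
  shows "null_vec H (A x - A y)"
  using is_adjoint_null[OF assms] assms(1) unfolding is_adjoint_def by (metis lin_diff)

lemma is_adjoint_adjointable: "is_adjoint H H A B \<Longrightarrow> A \<in> adjointable H H"
  by (auto simp: adjointable_def is_adjoint_null intro: is_adjoint_def[THEN iffD1, THEN conjunct1])

text \<open>Inner products with \<open>B y\<close> and \<open>B' y\<close> are inner products of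
  \<open>y\<close> with values of \<open>A\<close> and \<open>A'\<close>. At the end this carries
  the comparison of creators over to annihilators.\<close>

lemma is_adjoint_unique_mod_null:
  assumes "is_adjoint H H A B" "is_adjoint H H A' B'" "eq_mod_null H A A'"
  shows "eq_mod_null H B B'"
  using assms by (auto simp: is_adjoint_def eq_mod_null_def null_diff_iff_right null_diff_iff_left)
    (metis null_diff_iff_left null_diff_iff_right)

lemma linear_id: "Vector_Spaces.linear (scl H) (scl H) (\<lambda>x. x)"
  by (simp add: Vector_Spaces.linear_iff vector_space_axioms)

end

section \<open>Polynomials\<close>

abbreviation mon :: "('d \<Rightarrow>\<^sub>0 nat) \<Rightarrow> 'd cpoly" where
  "mon m \<equiv> Poly_Mapping.single m 1"

lemma lookup_pscale: "Poly_Mapping.lookup (pscale c p) m = c * Poly_Mapping.lookup p m"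
  unfolding pscale_def mult_map_scale_conv_mult[symmetric] by (simp add: map.rep_eq when_def)

global_interpretation poly: vector_space pscale
  by unfold_locales (auto intro!: poly_mapping_eqI simp: lookup_pscale lookup_add algebra_simps)

lemma pscale_mult: "pscale c p * q = pscale c (p * q)" "p * pscale c q = pscale c (p * q)"
  by (simp_all add: pscale_def mult_ac)

lemma pscale_single: "pscale c (Poly_Mapping.single m a) = Poly_Mapping.single m (c * a)"
  by (simp add: pscale_def mult_single)

lemma poly_induct [case_names zero add]:
  fixes p :: "'d cpoly"
  assumes "T 0" and "\<And>c m p. T p \<Longrightarrow> T (pscale c (mon m) + p)"
  shows "T p"
proof (induction p rule: update_induct)
  case const
  show ?case by fact
next
  case (update p m c)
  have "Poly_Mapping.update m c p = pscale c (mon m) + p"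
    using update(1)
    by (intro poly_mapping_eqI) (auto simp: lookup_update pscale_single lookup_add lookup_single in_keys_iff when_def)
  then show ?case using assms(2) update(3) by simp
qed

lemma span_mon: "poly.span (range mon) = UNIV"
proof -
  have "p \<in> poly.span (range mon)" for p :: "'a cpoly"
    by (induction p rule: poly_induct) (simp_all add: poly.span_zero poly.span_add poly.span_scale poly.span_base)
  then show ?thesis by auto
qed

lemma lin_eq_on_mon:
  assumes "Vector_Spaces.linear pscale s f" "Vector_Spaces.linear pscale s g"
    and "\<And>m. f (mon m) = g (mon m)"
  shows "f p = g p"
  using lin_eq_on_span[OF assms(1,2), of "range mon"] assms(3) span_mon by (metis UNIV_I rangeE)

definition lin_ext :: "(complex \<Rightarrow> 'h::ab_group_add \<Rightarrow> 'h) \<Rightarrow> (('d \<Rightarrow>\<^sub>0 nat) \<Rightarrow> 'h) \<Rightarrow> 'd cpoly \<Rightarrow> 'h" where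
  "lin_ext s g p = (\<Sum>m\<in>Poly_Mapping.keys p. s (Poly_Mapping.lookup p m) (g m))"


text \<open>Coefficients outside the support are zero, so several polynomials can be summed over one
  common index set. Additivity needs this, because terms may cancel in \<open>p + q\<close>.\<close>

lemma lin_ext_superset:
  assumes "vector_space s" "finite A" "Poly_Mapping.keys p \<subseteq> A"
  shows "lin_ext s g p = (\<Sum>m\<in>A. s (Poly_Mapping.lookup p m) (g m))"
proof -
  interpret v: vector_space s by fact
  show ?thesis unfolding lin_ext_def using assms(2,3)
    by (intro sum.mono_neutral_left) (auto simp: in_keys_iff)
qed

lemma linear_lin_ext:
  assumes "vector_space s"
  shows "Vector_Spaces.linear pscale s (lin_ext s g)"
proof -
  interpret v: vector_space s by fact
  have "lin_ext s g (p + q) = lin_ext s g p + lin_ext s g q" for p q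
  proof -
    let ?A = "Poly_Mapping.keys p \<union> Poly_Mapping.keys q"
    have "Poly_Mapping.keys (p + q) \<subseteq> ?A" by (rule keys_add)
    then show ?thesis
      by (simp add: lin_ext_superset[OF assms, of ?A] lookup_add v.scale_left_distrib sum.distrib)
  qed
  moreover have "lin_ext s g (pscale c p) = s c (lin_ext s g p)" for c p
  proof -
    have "Poly_Mapping.keys (pscale c p) \<subseteq> Poly_Mapping.keys p"
      by (auto simp: in_keys_iff lookup_pscale)
    then show ?thesis
      by (simp add: lin_ext_superset[OF assms, of "Poly_Mapping.keys p"] lookup_pscale v.scale_sum_right)
  qed
  ultimately show ?thesis
    using assms poly.vector_space_axioms by (simp add: Vector_Spaces.linear_iff)
qed

lemma lin_ext_mon: "vector_space s \<Longrightarrow> lin_ext s g (mon m) = g m"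
  by (simp add: lin_ext_def vector_space.vector_space_assms(4))

subsection \<open>Degrees\<close>

definition mdeg :: "('d::finite \<Rightarrow>\<^sub>0 nat) \<Rightarrow> nat" where
  "mdeg m = (\<Sum>j\<in>UNIV. Poly_Mapping.lookup m j)"

abbreviation unit_exp :: "'d \<Rightarrow> 'd \<Rightarrow>\<^sub>0 nat" where
  "unit_exp j \<equiv> Poly_Mapping.single j 1"

lemma mdeg_add: "mdeg (m + n) = mdeg m + mdeg n"
  by (simp add: mdeg_def lookup_add sum.distrib)

lemma mdeg_unit_exp: "mdeg (unit_exp j) = 1"
  by (simp add: mdeg_def lookup_single when_def)

lemma mdeg_eq_0_iff: "mdeg m = 0 \<longleftrightarrow> m = 0"
  by (auto simp: mdeg_def intro!: poly_mapping_eqI)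

lemma exponent_Suc:
  assumes "mdeg m = Suc n"
  obtains j m' where "m = unit_exp j + m'" "mdeg m' = n"
proof -
  obtain j where j: "Poly_Mapping.lookup m j \<noteq> 0"
    using assms by (metis mdeg_eq_0_iff nat.distinct(1) poly_mapping_eqI lookup_zero)
  have "m = unit_exp j + (m - unit_exp j)"
    using j by (intro poly_mapping_eqI) (auto simp: lookup_add lookup_minus lookup_single when_def)
  moreover from this have "mdeg m = 1 + mdeg (m - unit_exp j)"
    by (metis mdeg_add mdeg_unit_exp)
  ultimately show thesis using that assms by simp
qed

lemma exponent_induct [case_names zero add]:
  fixes m :: "'d::finite \<Rightarrow>\<^sub>0 nat"
  assumes "T 0" and "\<And>j m. T m \<Longrightarrow> T (unit_exp j + m)"
  shows "T m"
proof (induction "mdeg m" arbitrary: m)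
  case 0
  then show ?case using assms(1) mdeg_eq_0_iff[of m] by simp
next
  case (Suc n)
  from Suc(2) obtain j m' where "m = unit_exp j + m'" "mdeg m' = n"
    using exponent_Suc[of m n] by metis
  then show ?case using assms(2) Suc(1) by simp
qed

lemma pvar_mon: "pvar j * mon m = mon (unit_exp j + m)"
  by (simp add: pvar_def mult_single)

lemma linear_pvar: "Vector_Spaces.linear pscale pscale ((*) (pvar j))"
  by (simp add: Vector_Spaces.linear_iff poly.vector_space_axioms pscale_mult distrib_left)

lemma pvar_power: "pvar j ^ k = mon (Poly_Mapping.single j k)"
  by (induction k) (simp_all add: pvar_mon single_add[symmetric])

lemma prod_mon: "(\<Prod>i\<in>A. mon (f i)) = mon (\<Sum>i\<in>A. f i)"
  by (induction A rule: infinite_finite_induct) (simp_all add: mult_single)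

lemma lookup_Abs: "Poly_Mapping.lookup (Abs_poly_mapping n) = n" for n :: "'d::finite \<Rightarrow> nat"
  by (simp add: Abs_poly_mapping_inverse)

lemma pmonomial_eq: "pmonomial n = mon (Abs_poly_mapping n)"
proof -
  have "(\<Sum>j\<in>UNIV. Poly_Mapping.single j (n j)) = Abs_poly_mapping n"
    by (intro poly_mapping_eqI) (simp add: lookup_sum lookup_single lookup_Abs when_def)
  then show ?thesis by (simp add: pmonomial_def pvar_power prod_mon)
qed

lemma pmonomial_lookup: "pmonomial (Poly_Mapping.lookup m) = mon m"
  by (simp add: pmonomial_eq)

text \<open>The bound is strict, so that \<open>deg_lt 0\<close> is the zero space and inductions
  along the filtration start from nothing. Degree at most \<open>n\<close> is
  \<open>deg_lt (Suc n)\<close>.\<close>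

definition deg_lt :: "nat \<Rightarrow> 'd::finite cpoly set" where
  "deg_lt n = poly.span (mon ` {m. mdeg m < n})"

lemma subspace_deg_lt: "poly.subspace (deg_lt n)"
  by (simp add: deg_lt_def)

lemma mon_deg_lt: "mdeg m < n \<Longrightarrow> mon m \<in> deg_lt n"
  by (simp add: deg_lt_def poly.span_base)

lemma deg_lt_mono: "p \<in> deg_lt m \<Longrightarrow> m \<le> n \<Longrightarrow> p \<in> deg_lt n"
  unfolding deg_lt_def by (rule subsetD[OF poly.span_mono]) auto

lemma deg_lt_0: "deg_lt 0 = {0}"
  by (simp add: deg_lt_def)

lemma pvar_deg_lt:
  assumes "p \<in> deg_lt n"
  shows "pvar j * p \<in> deg_lt (Suc n)"
  using assms unfolding deg_lt_def
proof (induction rule: poly.span_induct_alt)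
  case base
  show ?case by (simp add: poly.span_zero)
next
  case (step c p q)
  then obtain m where m: "p = mon m" "mdeg m < n" by blast
  then have "pvar j * p \<in> poly.span (mon ` {m. mdeg m < Suc n})"
    unfolding m(1) pvar_mon by (intro poly.span_base imageI) (simp add: mdeg_add mdeg_unit_exp del: One_nat_def)
  then show ?case using step(2)
    by (simp add: distrib_left pscale_mult poly.span_add poly.span_scale)
qed

lemma deg_lt_exists: "\<exists>n. p \<in> deg_lt n"
proof (induction p rule: poly_induct)
  case zero
  show ?case by (auto simp: deg_lt_0 intro: exI[of _ 0])
next
  case (add c m p)
  then obtain n where "p \<in> deg_lt n" by blast
  then have "p \<in> deg_lt (max n (Suc (mdeg m)))" "mon m \<in> deg_lt (max n (Suc (mdeg m)))"
    by (auto intro: deg_lt_mono mon_deg_lt)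
  then show ?case
    by (blast intro: poly.subspace_add[OF subspace_deg_lt] poly.subspace_scale[OF subspace_deg_lt])
qed

subsection \<open>The involution and real polynomials\<close>

lemma lookup_pstar: "Poly_Mapping.lookup (pstar p) m = cnj (Poly_Mapping.lookup p m)"
  by (simp add: pstar_def map.rep_eq when_def)

lemma pstar_add: "pstar (p + q) = pstar p + pstar q"
  and pstar_diff: "pstar (p - q) = pstar p - pstar q"
  and pstar_pscale: "pstar (pscale c p) = pscale (cnj c) (pstar p)"
  and pstar_0: "pstar 0 = 0"
  and pstar_pstar: "pstar (pstar p) = p"
  by (auto intro!: poly_mapping_eqI simp: lookup_pstar lookup_add lookup_minus lookup_pscale)

lemma pstar_mon: "pstar (mon m) = mon m"
  by (intro poly_mapping_eqI) (simp add: lookup_pstar lookup_single when_def)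

lemma pstar_mon_mult: "pstar (mon m * q) = mon m * pstar q"
  by (induction q rule: poly_induct)
    (simp_all add: pstar_0 distrib_left pstar_add pstar_pscale pscale_mult mult_single pstar_mon)

lemma pstar_mult: "pstar (p * q) = pstar p * pstar q"
  by (induction p rule: poly_induct)
    (simp_all add: pstar_0 distrib_right pstar_add pstar_pscale pscale_mult pstar_mon_mult pstar_mon)

lemma pstar_pvar: "pstar (pvar j) = pvar j"
  by (simp add: pvar_def pstar_mon)

lemma pstar_1: "pstar 1 = 1"
  using pstar_mon[of 0] by simp

text \<open>Describing real polynomials as fixed points of the involution makes closure under
  products a consequence of \<open>pstar_mult\<close>.\<close>

lemma real_polys_iff: "p \<in> real_polys \<longleftrightarrow> pstar p = p"
  by (auto simp: real_polys_def poly_mapping_eq_iff fun_eq_iff lookup_pstar Reals_cnj_iff)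

lemma real_polys_add: "p \<in> real_polys \<Longrightarrow> q \<in> real_polys \<Longrightarrow> p + q \<in> real_polys"
  and real_polys_diff: "p \<in> real_polys \<Longrightarrow> q \<in> real_polys \<Longrightarrow> p - q \<in> real_polys"
  and real_polys_mult: "p \<in> real_polys \<Longrightarrow> q \<in> real_polys \<Longrightarrow> p * q \<in> real_polys"
  and real_polys_pscale: "c \<in> \<real> \<Longrightarrow> p \<in> real_polys \<Longrightarrow> pscale c p \<in> real_polys"
  and real_polys_0: "0 \<in> real_polys"
  and real_polys_mon: "mon m \<in> real_polys"
  and real_polys_pvar: "pvar j \<in> real_polys"
  by (simp_all add: real_polys_iff pstar_add pstar_diff pstar_mult pstar_pscale pstar_0 pstar_mon
      pstar_pvar Reals_cnj_iff)

lemma real_polys_sum: "(\<And>i. i \<in> A \<Longrightarrow> f i \<in> real_polys) \<Longrightarrow> sum f A \<in> real_polys"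
  by (induction A rule: infinite_finite_induct) (simp_all add: real_polys_0 real_polys_add)

lemma real_polys_1: "1 \<in> real_polys"
  using real_polys_mon[of 0] by simp

text \<open>Here \<open>R\<close> is in general only a real subspace; it is the realness of the
  coefficients of \<open>p\<close> that keeps the combination inside.\<close>

lemma lin_ext_closed:
  fixes p :: "'d cpoly"
  assumes "0 \<in> R" and "\<And>x y. x \<in> R \<Longrightarrow> y \<in> R \<Longrightarrow> x + y \<in> R"
    and "\<And>c x. c \<in> \<real> \<Longrightarrow> x \<in> R \<Longrightarrow> s c x \<in> R" and "\<And>m. g m \<in> R" and "p \<in> real_polys"
  shows "lin_ext s g p \<in> R"
proof -
  have sum_closed: "sum f A \<in> R" if "\<And>m. m \<in> A \<Longrightarrow> f m \<in> R" for f and A :: "('d \<Rightarrow>\<^sub>0 nat) set"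
    using that by (induction A rule: infinite_finite_induct) (auto intro: assms(1,2))
  show ?thesis using assms(5) unfolding lin_ext_def real_polys_def
    by (auto intro!: sum_closed assms(3,4))
qed

text \<open>Ensures that passing from one degree to the next takes only finitely many one-monomial
  extensions of a projection.\<close>

lemma finite_mdeg: "finite {m :: 'd::finite \<Rightarrow>\<^sub>0 nat. mdeg m = n}"
proof (induction n)
  case 0
  show ?case by (simp add: mdeg_eq_0_iff)
next
  case (Suc n)
  have "{m :: 'd \<Rightarrow>\<^sub>0 nat. mdeg m = Suc n} \<subseteq> (\<Union>j. (+) (unit_exp j) ` {m. mdeg m = n})"
  proof
    fix m :: "'d \<Rightarrow>\<^sub>0 nat" assume "m \<in> {m. mdeg m = Suc n}"
    then obtain j m' where "m = unit_exp j + m'" "mdeg m' = n" using exponent_Suc[of m n] by blast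
    then show "m \<in> (\<Union>j. (+) (unit_exp j) ` {m. mdeg m = n})" by blast
  qed
  moreover have "finite (\<Union>j::'d. (+) (unit_exp j) ` {m. mdeg m = n})"
    by (intro finite_UN_I finite_imageI Suc finite)
  ultimately show ?case by (rule finite_subset)
qed

section \<open>Existence of the orthogonal gradation\<close>

lemma scl_state_space [simp]: "scl (state_space \<phi>) = pscale"
  and ip_state_space: "ip (state_space \<phi>) a b = \<phi> (pstar a * b)"
  by (simp_all add: state_space_def)

locale poly_state =
  fixes \<phi> :: "'d::finite cpoly \<Rightarrow> complex"
  assumes state: "state \<phi>"
begin

abbreviation "S \<equiv> state_space \<phi>"

lemma linear_state: "Vector_Spaces.linear pscale (*) \<phi>"
  and state_1: "\<phi> 1 = 1"
  and state_real: "p \<in> real_polys \<Longrightarrow> \<phi> p \<in> \<real>"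
  using state by (simp_all add: state_def)

text \<open>Both sides are antilinear in \<open>p\<close>, and on monomials they agree because a
  state is real there. Hermitian symmetry of the form follows.\<close>

lemma state_pstar: "\<phi> (pstar p) = cnj (\<phi> p)"
proof (induction p rule: poly_induct)
  case zero
  show ?case by (simp add: pstar_0 lin_0[OF linear_state])
next
  case (add c m p)
  have "cnj (\<phi> (mon m)) = \<phi> (mon m)"
    using state_real[OF real_polys_mon] by (simp add: Reals_cnj_iff)
  with add show ?case
    by (simp add: pstar_add pstar_pscale pstar_mon lin_add[OF linear_state] lin_scale[OF linear_state])
qed

sublocale sp: prehilbert_space S
proof
  have "\<phi> (pstar y * x) = cnj (\<phi> (pstar x * y))" for x y
    using state_pstar[of "pstar x * y"] by (simp add: pstar_mult pstar_pstar mult.commute)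
  moreover have "Vector_Spaces.linear pscale (*) (\<lambda>y. \<phi> (pstar x * y))" for x
    using linear_state
    by (simp add: Vector_Spaces.linear_iff distrib_left pscale_mult)
  moreover have "\<phi> (pstar x * x) \<in> \<real>\<^sub>\<ge>\<^sub>0" for x
    using state by (simp add: state_def)
  moreover have ip_eq: "ip S x = (\<lambda>y. \<phi> (pstar x * y))" for x
    by (rule ext) (rule ip_state_space)
  ultimately show "pre_hilbert S"
    unfolding pre_hilbert_def scl_state_space ip_eq using poly.vector_space_axioms by blast
qed

lemmas ip_pscale_left = sp.ip_scale_left[unfolded scl_state_space]
  and ip_pscale_right = sp.ip_scale_right[unfolded scl_state_space]

lemma ip_pvar: "ip S (pvar j * a) b = ip S a (pvar j * b)"
  by (simp add: ip_state_space pstar_mult pstar_pvar mult_ac)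

lemma ip_real: "x \<in> real_polys \<Longrightarrow> y \<in> real_polys \<Longrightarrow> ip S x y \<in> \<real>"
  unfolding ip_state_space by (metis real_polys_iff real_polys_mult state_real)

text \<open>Idempotence is exact, while self-adjointness refers to a possibly degenerate form; so
  the range may fail to determine \<open>E\<close>.\<close>

definition real_projection :: "('d cpoly \<Rightarrow> 'd cpoly) \<Rightarrow> bool" where
  "real_projection E \<longleftrightarrow> self_adjoint S E \<and> (\<forall>x. E (E x) = E x) \<and> E ` real_polys \<subseteq> real_polys"

text \<open>The orthogonal projection onto \<open>w = v - E v\<close> is added to \<open>E\<close>; if \<open>w\<close> is a zero-norm vector,
  any real functional \<open>l\<close> with \<open>l w = 1\<close> that kills the range of \<open>E\<close> can take the place of
  the inner product with \<open>w\<close>.\<close>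

lemma extend_projection:
  assumes E: "real_projection E" and v: "v \<in> real_polys"
  shows "\<exists>E'. real_projection E' \<and> range E' = poly.span (insert v (range E)) \<and>
    (\<forall>x. E (E' x) = E x) \<and> (\<forall>x. E' (E x) = E x)"
proof -
  have linE: "Vector_Spaces.linear pscale pscale E" and adjE: "ip S (E x) y = ip S x (E y)"
    and EE: "E (E x) = E x" and realE: "x \<in> real_polys \<Longrightarrow> E x \<in> real_polys" for x y
    using E by (auto simp: real_projection_def is_adjoint_def)
  define w where "w = v - E v"
  have w: "w \<in> real_polys" and Ew: "E w = 0"
    using v by (simp_all add: w_def real_polys_diff realE lin_diff[OF linE] EE)
  \<comment> \<open>These are the properties that make \<open>E x + pscale (l x) w\<close> a real
    self-adjoint projection; the last one is self-adjointness of the added term. Writing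
    \<open>pscale (l w) w = w\<close> in place of \<open>l w = 1\<close> covers \<open>w = 0\<close>
    as well.\<close>
  have "\<exists>l. Vector_Spaces.linear pscale (*) l \<and> (\<forall>x. l (E x) = 0) \<and> (\<forall>x\<in>real_polys. l x \<in> \<real>) \<and>
      pscale (l w) w = w \<and> (\<forall>x y. cnj (l x) * ip S w y = l y * ip S x w)"
  proof (cases "null_vec S w")
    case True
    show ?thesis
    proof (cases "w = 0")
      case True
      have "Vector_Spaces.linear pscale (*) (\<lambda>_ :: 'd cpoly. 0 :: complex)"
        using linear_state by (simp add: Vector_Spaces.linear_iff)
      with True show ?thesis by (intro exI[of _ "\<lambda>_. 0"]) simp
    next
      case False
      then obtain m where m: "Poly_Mapping.lookup w m \<noteq> 0"
        by (metis poly_mapping_eqI lookup_zero)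
      \<comment> \<open>Subtracting \<open>E x\<close> makes the functional vanish on the range of
        \<open>E\<close>. As \<open>E w = 0\<close>, its value at \<open>w\<close> is the quotient
        of a nonzero coefficient by itself.\<close>
      let ?l = "\<lambda>x. Poly_Mapping.lookup (x - E x) m / Poly_Mapping.lookup w m"
      have "Vector_Spaces.linear pscale (*) ?l"
        using linear_state linE
        by (simp add: Vector_Spaces.linear_iff lookup_minus lookup_add lookup_pscale
            add_divide_distrib diff_divide_distrib right_diff_distrib)
      moreover have "?l x \<in> \<real>" if "x \<in> real_polys" for x
        using that w realE[OF that] by (simp add: real_polys_def lookup_minus)
      ultimately show ?thesis
        using m \<open>null_vec S w\<close> by (intro exI[of _ ?l]) (simp add: EE Ew sp.null_ip_left sp.null_ip_right)
    qed
  next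
    case False
    let ?l = "\<lambda>x. ip S w x / ip S w w"
    have "Vector_Spaces.linear pscale (*) ?l"
      using sp.linear_ip[of w] by (simp add: Vector_Spaces.linear_iff add_divide_distrib)
    moreover have "?l x \<in> \<real>" if "x \<in> real_polys" for x
      using that w by (simp add: ip_real)
    moreover have "?l (E x) = 0" for x
      by (simp add: adjE[symmetric] Ew sp.ip_zero_left)
    moreover have "cnj (?l x) * ip S w y = ?l y * ip S x w" for x y
      unfolding sp.ip_commute[of x w] using ip_real[OF w w] by (simp add: Reals_cnj_iff)
    ultimately show ?thesis
      using False by (intro exI[of _ ?l]) (simp add: null_vec_def)
  qed
  then obtain l where linl: "Vector_Spaces.linear pscale (*) l" and lE: "\<And>x. l (E x) = 0"
    and reall: "\<And>x. x \<in> real_polys \<Longrightarrow> l x \<in> \<real>" and lw: "pscale (l w) w = w"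
    and syml: "\<And>x y. cnj (l x) * ip S w y = l y * ip S x w"
    by blast
  define E' where "E' = (\<lambda>x. E x + pscale (l x) w)"
  have linE': "Vector_Spaces.linear pscale pscale E'"
    using linE linl
    by (simp add: Vector_Spaces.linear_iff E'_def poly.scale_left_distrib poly.scale_right_distrib algebra_simps)
  have E'E: "E' (E x) = E x" and EE': "E (E' x) = E x" for x
    by (simp_all add: E'_def lE EE lin_add[OF linE] lin_scale[OF linE] Ew)
  have E'w: "E' w = w" by (simp add: E'_def Ew lw)
  have "real_projection E'"
    unfolding real_projection_def is_adjoint_def
  proof (intro conjI allI)
    show "ip S (E' x) y = ip S x (E' y)" for x y
      by (simp add: E'_def sp.ip_add_left sp.ip_add_right ip_pscale_left ip_pscale_right adjE syml)
    show "E' (E' x) = E' x" for x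
      unfolding E'_def[THEN fun_cong, of x] by (simp add: lin_add[OF linE'] lin_scale[OF linE'] E'E E'w)
    show "E' ` real_polys \<subseteq> real_polys"
      by (auto simp: E'_def intro!: real_polys_add real_polys_pscale realE reall w)
  qed (simp_all add: linE')
  moreover have "range E' = poly.span (insert v (range E))"
  proof
    show "range E' \<subseteq> poly.span (insert v (range E))"
      by (auto simp: E'_def w_def intro!: poly.span_add poly.span_scale poly.span_diff intro: poly.span_base)
    have "E' v = v"
      using E'w by (simp add: w_def lin_diff[OF linE'] E'E)
    then have "insert v (range E) \<subseteq> range E'"
      using E'E by (metis image_subsetI insert_subset rangeI)
    moreover have "poly.subspace (range E')"
      using linE' by (rule subspace_range)
    ultimately show "poly.span (insert v (range E)) \<subseteq> range E'"
      by (rule poly.span_minimal)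
  qed
  ultimately show ?thesis using E'E EE' by blast
qed

text \<open>The compatibility relations in both orders compose along the chain \<open>E\<close>,
  \<open>E1\<close>, \<open>E2\<close>. They later make differences of such projections idempotent
  and mutually annihilating.\<close>

lemma extend_projection_finite:
  assumes "finite A" "A \<subseteq> real_polys" and E: "real_projection E"
  shows "\<exists>E'. real_projection E' \<and> range E' = poly.span (A \<union> range E) \<and>
    (\<forall>x. E (E' x) = E x) \<and> (\<forall>x. E' (E x) = E x)"
  using assms(1,2)
proof (induction A)
  case empty
  have "poly.subspace (range E)"
    using E by (intro subspace_range[of pscale]) (simp add: real_projection_def is_adjoint_def)
  then have "poly.span ({} \<union> range E) = range E" by simp
  then show ?case using E unfolding real_projection_def by metis
next
  case (insert v A)
  then obtain E1 where E1: "real_projection E1" "range E1 = poly.span (A \<union> range E)"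
    "\<And>x. E (E1 x) = E x" "\<And>x. E1 (E x) = E x" by auto
  from extend_projection[OF E1(1), of v] insert.prems obtain E2 where E2: "real_projection E2"
    "range E2 = poly.span (insert v (range E1))" "\<And>x. E1 (E2 x) = E1 x" "\<And>x. E2 (E1 x) = E1 x"
    by auto
  have "range E2 = poly.span (insert v A \<union> range E)"
    unfolding E2(2) E1(2)
  proof (rule equalityI; rule poly.span_minimal)
    show "insert v (poly.span (A \<union> range E)) \<subseteq> poly.span (insert v A \<union> range E)"
      using poly.span_mono[of "A \<union> range E" "insert v A \<union> range E"] by (auto intro: poly.span_base)
    show "insert v A \<union> range E \<subseteq> poly.span (insert v (poly.span (A \<union> range E)))"
      by (auto intro!: poly.span_base)
  qed simp_all
  moreover have "E (E2 x) = E x" "E2 (E x) = E x" for x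
    using E1(3,4) E2(3,4) by metis+
  ultimately show ?case using E2(1) by blast
qed

lemma deg_lt_Suc: "deg_lt (Suc n) = poly.span (mon ` {m. mdeg m = n} \<union> deg_lt n)"
  unfolding deg_lt_def
proof (rule equalityI; rule poly.span_minimal)
  show "mon ` {m. mdeg m < Suc n} \<subseteq> poly.span (mon ` {m. mdeg m = n} \<union> poly.span (mon ` {m. mdeg m < n}))"
    by (auto simp: less_Suc_eq intro!: poly.span_base)
  show "mon ` {m. mdeg m = n} \<union> poly.span (mon ` {m. mdeg m < n}) \<subseteq> poly.span (mon ` {m. mdeg m < Suc n})"
    using deg_lt_mono[of _ n "Suc n"] unfolding deg_lt_def by (auto intro: poly.span_base)
qed simp_all

lemma real_projection_vacuum: "real_projection (\<lambda>Q. pscale (\<phi> Q) 1)"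
  unfolding real_projection_def is_adjoint_def
proof (intro conjI allI)
  show "Vector_Spaces.linear (scl S) (scl S) (\<lambda>Q. pscale (\<phi> Q) 1)"
    using linear_state by (simp add: Vector_Spaces.linear_iff poly.scale_left_distrib)
  then show "Vector_Spaces.linear (scl S) (scl S) (\<lambda>Q. pscale (\<phi> Q) 1)" .
  show "ip S (pscale (\<phi> x) 1) y = ip S x (pscale (\<phi> y) 1)" for x y
    by (simp add: ip_state_space state_pstar pstar_1 pstar_pscale pscale_mult lin_scale[OF linear_state])
  show "(\<lambda>Q. pscale (\<phi> Q) 1) ` real_polys \<subseteq> real_polys"
    by (auto intro!: real_polys_pscale real_polys_1 state_real)
qed (simp_all add: lin_scale[OF linear_state] state_1)

lemma range_vacuum: "range (\<lambda>Q. pscale (\<phi> Q) 1) = poly.span {1}"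
proof -
  have "\<phi> (pscale c 1) = c" for c by (simp add: lin_scale[OF linear_state] state_1)
  then have "range \<phi> = UNIV" by (rule surjI)
  then have "(\<lambda>c. pscale c 1) ` range \<phi> = poly.span {1}" by (simp add: poly.span_singleton)
  then show ?thesis by (simp only: image_image)
qed

lemma filtration_projections:
  "\<exists>E. E 0 = (\<lambda>Q. pscale (\<phi> Q) 1) \<and> (\<forall>n. real_projection (E n) \<and> range (E n) = deg_lt (Suc n) \<and>
    (\<forall>x. E n (E (Suc n) x) = E n x) \<and> (\<forall>x. E (Suc n) (E n x) = E n x))"
proof -
  \<comment> \<open>The clause for \<open>n = 0\<close> is part of the invariant: dependent choice
    would otherwise leave the first projection open, whereas \<open>P 0\<close> is
    prescribed.\<close>
  have "\<exists>E. \<forall>n. (real_projection (E n) \<and> range (E n) = deg_lt (Suc n) \<and> (n = 0 \<longrightarrow> E n = (\<lambda>Q. pscale (\<phi> Q) 1))) \<and>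
    ((\<forall>x. E n (E (Suc n) x) = E n x) \<and> (\<forall>x. E (Suc n) (E n x) = E n x))"
  proof (rule dependent_nat_choice)
    have "{m. mdeg m = 0} = {0 :: 'd \<Rightarrow>\<^sub>0 nat}" by (auto simp: mdeg_eq_0_iff)
    then have "deg_lt (Suc 0) = poly.span {1 :: 'd cpoly}"
      by (simp add: deg_lt_def)
    then show "\<exists>E. real_projection E \<and> range E = deg_lt (Suc 0) \<and> (0 = 0 \<longrightarrow> E = (\<lambda>Q. pscale (\<phi> Q) 1))"
      using real_projection_vacuum range_vacuum by simp
  next
    fix E n
    assume "real_projection E \<and> range E = deg_lt (Suc n) \<and> (n = 0 \<longrightarrow> E = (\<lambda>Q. pscale (\<phi> Q) 1))"
    moreover have "finite (mon ` {m :: 'd \<Rightarrow>\<^sub>0 nat. mdeg m = Suc n})" by (simp add: finite_mdeg)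
    moreover have "mon ` {m :: 'd \<Rightarrow>\<^sub>0 nat. mdeg m = Suc n} \<subseteq> real_polys" by (auto simp: real_polys_mon)
    ultimately show "\<exists>E'. (real_projection E' \<and> range E' = deg_lt (Suc (Suc n)) \<and> (Suc n = 0 \<longrightarrow> E' = (\<lambda>Q. pscale (\<phi> Q) 1))) \<and>
       ((\<forall>x. E (E' x) = E x) \<and> (\<forall>x. E' (E x) = E x))"
      using extend_projection_finite[of "mon ` {m. mdeg m = Suc n}" E] by (auto simp: deg_lt_Suc[of "Suc n"])
  qed
  then show ?thesis by metis
qed

text \<open>Replaces exponents given as functions by finitely supported ones; as there are finitely
  many variables, every function is of this kind.\<close>

lemma ortho_space_Suc:
  "ortho_space P (Suc n) = poly.span ((\<lambda>m. mon m - (\<Sum>k\<le>n. P k (mon m))) ` {m. mdeg m = Suc n})"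
proof -
  have "{pmonomial m - (\<Sum>k\<le>n. P k (pmonomial m)) | m. (\<Sum>j\<in>UNIV. m j) = Suc n} =
    (\<lambda>m. mon m - (\<Sum>k\<le>n. P k (mon m))) ` {m. mdeg m = Suc n}" (is "?A = ?f ` ?B")
  proof (intro equalityI subsetI)
    fix x assume "x \<in> ?A"
    then obtain m where "x = pmonomial m - (\<Sum>k\<le>n. P k (pmonomial m))" "(\<Sum>j\<in>UNIV. m j) = Suc n" by blast
    then show "x \<in> ?f ` ?B"
      by (intro image_eqI[of _ _ "Abs_poly_mapping m"]) (simp_all add: pmonomial_eq mdeg_def lookup_Abs)
  next
    fix x assume "x \<in> ?f ` ?B"
    then obtain m where "x = ?f m" "mdeg m = Suc n" by blast
    then show "x \<in> ?A" unfolding mdeg_def pmonomial_lookup[symmetric] by blast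
  qed
  then show ?thesis by simp
qed

text \<open>The projections are the successive differences of an increasing chain. Their sums
  telescope to the chain, and compatibility of the chain in both orders gives exact vanishing of the
  mixed products.\<close>

lemma orthogonal_gradation_exists: "\<exists>P. orthogonal_gradation \<phi> P"
proof -
  obtain E where E0: "E 0 = (\<lambda>Q. pscale (\<phi> Q) 1)" and E: "\<And>n. real_projection (E n)"
    and rangeE: "\<And>n. range (E n) = deg_lt (Suc n)" and EES: "\<And>n x. E n (E (Suc n) x) = E n x"
    and ESE: "\<And>n x. E (Suc n) (E n x) = E n x"
    using filtration_projections by blast
  have linE: "Vector_Spaces.linear pscale pscale (E n)" and adjE: "ip S (E n x) y = ip S x (E n y)"
    and EE: "E n (E n x) = E n x" and realE: "x \<in> real_polys \<Longrightarrow> E n x \<in> real_polys" for n x y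
    using E[of n] by (auto simp: real_projection_def is_adjoint_def)
  have up: "E k (E n x) = E k x \<and> E n (E k x) = E k x" if "k \<le> n" for k n x
    using that
  proof (induction n arbitrary: x rule: dec_induct)
    case base
    show ?case by (simp add: EE)
  next
    case (step n)
    then show ?case using EES ESE by metis
  qed
  define P where "P n = (case n of 0 \<Rightarrow> E 0 | Suc k \<Rightarrow> (\<lambda>x. E (Suc k) x - E k x))" for n
  have P_Suc: "P (Suc n) = (\<lambda>x. E (Suc n) x - E n x)" for n by (simp add: P_def)
  have sumP: "(\<Sum>k\<le>n. P k x) = E n x" for n x
    by (induction n) (simp_all add: P_def)
  have linP: "Vector_Spaces.linear pscale pscale (P (Suc n))" for n
    unfolding P_Suc using linE by (intro lin_minus)
  have PE: "P (Suc n) (E k x) = 0" and EP: "E k (P (Suc n) x) = 0" if "k \<le> n" for k n x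
    using that up[of k n] up[of k "Suc n"] by (simp_all add: P_Suc lin_diff[OF linE])
  have E_id: "E n p = p" if "p \<in> deg_lt (Suc n)" for n p
    using that EE[of n] unfolding rangeE[symmetric] by auto
  have "range (P (Suc n)) = ortho_space P (Suc n)" for n
    unfolding ortho_space_Suc sumP
  proof (rule equalityI)
    let ?B = "(\<lambda>m. mon m - E n (mon m)) ` {m. mdeg m = Suc n}"
    \<comment> \<open>Residuals are linear in \<open>p\<close>, and \<open>E n\<close> fixes
      monomials of degree at most \<open>n\<close>; hence only monomials of degree
      \<open>Suc n\<close> contribute.\<close>
    have "p - E n p \<in> poly.span ?B" if "p \<in> deg_lt (Suc (Suc n))" for p
      using that unfolding deg_lt_def
    proof (induction rule: poly.span_induct_alt)
      case base
      show ?case by (simp add: lin_0[OF linE] poly.span_zero)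
    next
      case (step c p q)
      then obtain m where m: "p = mon m" "mdeg m < Suc (Suc n)" by blast
      have "p - E n p \<in> poly.span ?B"
      proof (cases "mdeg m = Suc n")
        case True
        then show ?thesis using m by (auto intro: poly.span_base)
      next
        case False
        then show ?thesis using m E_id[OF mon_deg_lt, of m n] by (simp add: poly.span_zero)
      qed
      then have "pscale c (p - E n p) + (q - E n q) \<in> poly.span ?B"
        using step(2) by (intro poly.span_add poly.span_scale)
      then show ?case
        by (simp add: lin_add[OF linE] lin_scale[OF linE] poly.scale_right_diff_distrib algebra_simps)
    qed
    then have "E (Suc n) x - E n (E (Suc n) x) \<in> poly.span ?B" for x
      using rangeE by blast
    then show "range (P (Suc n)) \<subseteq> poly.span ?B"
      by (auto simp: P_Suc EES)
    have "mon m - E n (mon m) = P (Suc n) (mon m)" if "mdeg m = Suc n" for m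
      using that E_id[OF mon_deg_lt, of m "Suc n"] by (simp add: P_Suc)
    then have "?B \<subseteq> range (P (Suc n))" by auto
    moreover have "poly.subspace (range (P (Suc n)))"
      using linP by (rule subspace_range)
    ultimately show "poly.span ?B \<subseteq> range (P (Suc n))" by (rule poly.span_minimal)
  qed
  moreover have "self_adjoint S (P (Suc n))" for n
    using linP by (simp add: is_adjoint_def) (simp add: P_Suc sp.ip_diff_left sp.ip_diff_right adjE)
  moreover have "P (Suc n) \<circ> P (Suc n) = P (Suc n)" for n
    using up[of n "Suc n"] by (auto simp: P_Suc lin_diff[OF linE] EE)
  moreover have "P (Suc n) ` real_polys \<subseteq> real_polys" for n
    by (auto simp: P_Suc intro!: real_polys_diff realE)
  moreover have "P (Suc n) \<circ> P k = (\<lambda>_. 0) \<and> P k \<circ> P (Suc n) = (\<lambda>_. 0)" if "k \<le> n" for k n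
  proof (cases k)
    case 0
    then show ?thesis using PE[of 0 n] EP[of 0 n] by (auto simp: P_def[of 0])
  next
    case (Suc i)
    then show ?thesis
      using that PE[of "Suc i" n] EP[of "Suc i" n] PE[of i n] EP[of i n]
      by (auto simp: P_Suc[of i] lin_diff[OF linP])
  qed
  ultimately have "orthogonal_gradation \<phi> P"
    by (simp add: orthogonal_gradation_def P_def[of 0] E0)
  then show ?thesis by blast
qed

end

section \<open>The interacting Fock space of a state\<close>

declare ortho_space.simps(2) [simp del]

locale gradation = poly_state +
  fixes P :: "nat \<Rightarrow> 'a cpoly \<Rightarrow> 'a cpoly"
  assumes gradation: "orthogonal_gradation \<phi> P"
begin

lemma P_0: "P 0 = (\<lambda>Q. pscale (\<phi> Q) 1)"
  using gradation by (simp add: orthogonal_gradation_def)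

lemma P_Suc:
  shows "self_adjoint S (P (Suc n))" "P (Suc n) \<circ> P (Suc n) = P (Suc n)"
    "range (P (Suc n)) = ortho_space P (Suc n)" "P (Suc n) ` real_polys \<subseteq> real_polys"
    "k \<le> n \<Longrightarrow> P (Suc n) \<circ> P k = (\<lambda>_. 0)" "k \<le> n \<Longrightarrow> P k \<circ> P (Suc n) = (\<lambda>_. 0)"
  using gradation unfolding orthogonal_gradation_def by blast+

lemma real_projection_P: "real_projection (P n)"
proof (cases n)
  case 0
  then show ?thesis using real_projection_vacuum by (simp add: P_0)
next
  case (Suc k)
  then show ?thesis
    using P_Suc(1,4)[of k] P_Suc(2)[of k, THEN fun_cong] by (simp add: real_projection_def)
qed

lemma self_adjoint_P: "self_adjoint S (P n)"
  and P_idem: "P n (P n x) = P n x"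
  and P_real: "x \<in> real_polys \<Longrightarrow> P n x \<in> real_polys"
  using real_projection_P[of n] by (auto simp: real_projection_def)

lemma linear_P: "Vector_Spaces.linear pscale pscale (P n)"
  and ip_P: "ip S (P n x) y = ip S x (P n y)"
  using self_adjoint_P[of n] by (auto simp: is_adjoint_def)

lemmas P_zero = lin_0[OF linear_P]
  and P_add = lin_add[OF linear_P]
  and P_pscale = lin_scale[OF linear_P]
  and P_sum = lin_sum[OF linear_P]

lemma P_orth:
  assumes "k \<noteq> n"
  shows "P k (P n x) = 0"
proof (cases k n rule: linorder_cases)
  case less
  then obtain i where "n = Suc i" "k \<le> i" by (cases n) auto
  then show ?thesis using P_Suc(6)[of k i, THEN fun_cong] by simp
next
  case greater
  then obtain i where "k = Suc i" "n \<le> i" by (cases k) auto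
  then show ?thesis using P_Suc(5)[of n i, THEN fun_cong] by simp
qed (use assms in simp)

lemma range_P: "range (P n) = ortho_space P n"
  using range_vacuum P_Suc(3) by (cases n) (simp_all add: P_0)

text \<open>Homogeneity of degree \<open>n\<close> is expressed below by the equation
  \<open>P n x = x\<close>, which can be substituted into the projections.\<close>

lemma P_fixed_iff: "P n x = x \<longleftrightarrow> x \<in> ortho_space P n"
  unfolding range_P[symmetric] using P_idem by (metis imageE rangeI)

text \<open>The projection onto degree below \<open>n\<close>. With the strict index the spaces
  \<open>ortho_space P n\<close> get one description that includes \<open>n = 0\<close>, where the
  sum is empty.\<close>

definition P_lt :: "nat \<Rightarrow> 'a cpoly \<Rightarrow> 'a cpoly" where
  "P_lt n x = (\<Sum>k<n. P k x)"

lemma linear_P_lt: "Vector_Spaces.linear pscale pscale (P_lt n)"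
  using linear_P
  by (simp add: Vector_Spaces.linear_iff P_lt_def sum.distrib poly.scale_sum_right)

lemma ortho_space_P_lt: "ortho_space P n = poly.span ((\<lambda>m. mon m - P_lt n (mon m)) ` {m. mdeg m = n})"
proof (cases n)
  case 0
  have "{m. mdeg m = 0} = {0 :: 'a \<Rightarrow>\<^sub>0 nat}" by (auto simp: mdeg_eq_0_iff)
  then show ?thesis by (simp add: 0 P_lt_def)
next
  case (Suc k)
  then show ?thesis by (simp only: ortho_space_Suc P_lt_def lessThan_Suc_atMost)
qed

text \<open>That the partial sums project onto the filtration is deduced here from the ranges and
  mutual annihilation of the \<open>P k\<close>. For \<open>mdeg m = n\<close> the vector
  \<open>mon m - P_lt n (mon m)\<close> lies in the range of \<open>P n\<close>, so
  \<open>P n\<close> fixes it; since \<open>P n\<close> kills \<open>P_lt n (mon m)\<close>, the two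
  parts add up to \<open>mon m\<close>. Both halves are proved together because the range of
  \<open>P n\<close> is bounded by means of the previous step.\<close>

lemma P_lt_aux: "P_lt n x \<in> deg_lt n \<and> (x \<in> deg_lt n \<longrightarrow> P_lt n x = x)"
proof (induction n arbitrary: x)
  case 0
  show ?case by (simp add: P_lt_def deg_lt_0)
next
  case (Suc n)
  have split: "P_lt (Suc n) y = P_lt n y + P n y" for y by (simp add: P_lt_def)
  have "(\<lambda>m. mon m - P_lt n (mon m)) ` {m. mdeg m = n} \<subseteq> deg_lt (Suc n)"
    using Suc.IH deg_lt_mono[of _ n "Suc n"]
    by (auto intro!: poly.subspace_diff[OF subspace_deg_lt] mon_deg_lt)
  then have "ortho_space P n \<subseteq> deg_lt (Suc n)"
    unfolding ortho_space_P_lt by (rule poly.span_minimal) (rule subspace_deg_lt)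
  then have "P n x \<in> deg_lt (Suc n)" using range_P by blast
  then have in_deg: "P_lt (Suc n) x \<in> deg_lt (Suc n)"
    using Suc.IH[of x] deg_lt_mono[of _ n "Suc n"]
    by (auto simp: split intro!: poly.subspace_add[OF subspace_deg_lt])
  have P_P_lt: "P n (P_lt n y) = 0" for y
    by (simp add: P_lt_def P_sum P_orth)
  have P_lt_P: "P_lt n (P n y) = 0" for y
    by (simp add: P_lt_def P_orth)
  have "P_lt (Suc n) (mon m) = mon m" if "mdeg m < Suc n" for m
  proof (cases "mdeg m = n")
    case True
    let ?w = "mon m - P_lt n (mon m)"
    have "?w \<in> ortho_space P n"
      unfolding ortho_space_P_lt using True by (intro poly.span_base) blast
    then have "P n ?w = ?w" by (simp add: P_fixed_iff)
    then have "P n (mon m) = ?w"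
      by (simp add: lin_diff[OF linear_P] P_P_lt)
    then show ?thesis by (simp add: split)
  next
    case False
    then have "P_lt n (mon m) = mon m" using that Suc.IH mon_deg_lt[of m n] by simp
    then show ?thesis using P_P_lt[of "mon m"] by (simp add: split)
  qed
  then have "P_lt (Suc n) x = x" if "x \<in> deg_lt (Suc n)"
    using lin_eq_on_span[OF linear_P_lt sp.linear_id[unfolded scl_state_space], of "mon ` {m. mdeg m < Suc n}"] that
    unfolding deg_lt_def by blast
  with in_deg show ?case by blast
qed

lemma P_lt_deg: "P_lt n x \<in> deg_lt n"
  and P_lt_id: "x \<in> deg_lt n \<Longrightarrow> P_lt n x = x"
  using P_lt_aux by blast+

lemma P_deg: "P n x \<in> deg_lt (Suc n)"
proof -
  have "P n x = P_lt (Suc n) x - P_lt n x" by (simp add: P_lt_def)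
  then show ?thesis
    using P_lt_deg[of "Suc n" x] deg_lt_mono[OF P_lt_deg, of n "Suc n" x]
    by (simp add: poly.subspace_diff[OF subspace_deg_lt])
qed

text \<open>As \<open>P_lt k\<close> fixes \<open>x\<close>, only components below \<open>k\<close>
  occur, and \<open>P n\<close> annihilates each of them. The vanishing is exact; the exact
  identities for creators depend on it.\<close>

lemma P_eq_0:
  assumes "x \<in> deg_lt k" "k \<le> n"
  shows "P n x = 0"
proof -
  have "P n (P_lt k x) = 0" using assms(2) by (simp add: P_lt_def P_sum P_orth)
  then show ?thesis using P_lt_id[OF assms(1)] by simp
qed

lemma sum_P: "x \<in> deg_lt n \<Longrightarrow> (\<Sum>k<n. P k x) = x"
  using P_lt_id unfolding P_lt_def .

lemma P_mon: "mdeg m = n \<Longrightarrow> P n (mon m) = mon m - P_lt n (mon m)"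
  using P_lt_id[OF mon_deg_lt, of m "Suc n"] by (simp add: P_lt_def algebra_simps)

lemma ortho_space_P_mon: "ortho_space P n = poly.span ((\<lambda>m. P n (mon m)) ` {m. mdeg m = n})"
  unfolding ortho_space_P_lt by (intro arg_cong[of _ _ poly.span] image_cong) (simp_all add: P_mon)

lemma graded_induct [case_names homogeneous add]:
  assumes hom: "\<And>n x. P n x = x \<Longrightarrow> T x" and add: "\<And>x y. T x \<Longrightarrow> T y \<Longrightarrow> T (x + y)"
  shows "T Q"
proof -
  obtain n where n: "Q \<in> deg_lt n" using deg_lt_exists by blast
  have "T (\<Sum>k<n. P k Q)" for n
    by (induction n) (auto intro!: add hom[of 0 0] simp: P_zero intro: hom[OF P_idem])
  then show ?thesis using sum_P[OF n] by metis
qed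

text \<open>These vectors span everything, and on them creators merely shift exponents.\<close>

lemma linear_eq_on_P_mon:
  assumes "Vector_Spaces.linear pscale s f" "Vector_Spaces.linear pscale s g"
    and "\<And>n m. mdeg m = n \<Longrightarrow> f (P n (mon m)) = g (P n (mon m))"
  shows "f x = g x"
proof (induction x rule: graded_induct)
  case (homogeneous n x)
  then show ?case
    using lin_eq_on_span[OF assms(1,2), of "(\<lambda>m. P n (mon m)) ` {m. mdeg m = n}" x] assms(3)
    by (auto simp: P_fixed_iff ortho_space_P_mon)
next
  case (add x y)
  then show ?case by (simp add: lin_add[OF assms(1)] lin_add[OF assms(2)])
qed

text \<open>Common form of the three parts of the quantum decomposition and of the isomorphism
  \<open>U\<close>, so that linearity is proved once.\<close>

definition graded_map :: "(nat \<Rightarrow> 'a cpoly \<Rightarrow> 'h::ab_group_add) \<Rightarrow> 'a cpoly \<Rightarrow> 'h" where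
  "graded_map f Q = (\<Sum>n | P n Q \<noteq> 0. f n (P n Q))"

lemma P_support: "Q \<in> deg_lt N \<Longrightarrow> {n. P n Q \<noteq> 0} \<subseteq> {..<N}"
  using P_eq_0[of Q N] by (metis (mono_tags, lifting) lessThan_iff linorder_not_less mem_Collect_eq subsetI)

text \<open>Trades the support, which varies with \<open>Q\<close>, for a fixed range of degrees
  that can be shared by several polynomials.\<close>

lemma graded_map_eq:
  assumes "\<And>n. f n 0 = 0" "Q \<in> deg_lt N"
  shows "graded_map f Q = (\<Sum>n<N. f n (P n Q))"
  unfolding graded_map_def using P_support[OF assms(2)]
  by (intro sum.mono_neutral_left) (auto simp: assms(1))

lemma linear_graded_map:
  assumes "\<And>n. Vector_Spaces.linear pscale s (f n)"
  shows "Vector_Spaces.linear pscale s (graded_map f)"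
proof -
  interpret v: vector_space s using linear_spaces(2)[OF assms] .
  have "f n 0 = 0" for n by (rule lin_0[OF assms])
  note eq = graded_map_eq[of f, OF this]
  have "graded_map f (x + y) = graded_map f x + graded_map f y" for x y
  proof -
    obtain n k where "x \<in> deg_lt n" "y \<in> deg_lt k" using deg_lt_exists by metis
    then have x: "x \<in> deg_lt (max n k)" and y: "y \<in> deg_lt (max n k)" by (auto elim: deg_lt_mono)
    then have xy: "x + y \<in> deg_lt (max n k)" by (rule poly.subspace_add[OF subspace_deg_lt])
    show ?thesis
      by (simp add: eq[OF x] eq[OF y] eq[OF xy] P_add lin_add[OF assms] sum.distrib)
  qed
  moreover have "graded_map f (pscale c x) = s c (graded_map f x)" for c x
  proof -
    obtain n where x: "x \<in> deg_lt n" using deg_lt_exists by metis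
    then have cx: "pscale c x \<in> deg_lt n" by (rule poly.subspace_scale[OF subspace_deg_lt])
    show ?thesis
      by (simp add: P_pscale lin_scale[OF assms] v.scale_sum_right
          eq[OF x] eq[OF cx])
  qed
  ultimately show ?thesis
    using poly.vector_space_axioms v.vector_space_axioms by (simp add: Vector_Spaces.linear_iff)
qed

lemma graded_map_homogeneous:
  assumes "f n 0 = 0" "P n x = x"
  shows "graded_map f x = f n x"
proof -
  have "{k. P k x \<noteq> 0} = (if x = 0 then {} else {n})"
    using P_orth[of _ n x] assms(2) P_zero by auto
  then show ?thesis using assms by (auto simp: graded_map_def)
qed

section \<open>The components of the quantum decomposition and their adjoints\<close>

lemma qd_eq_graded_map:
  "qd_plus P j = graded_map (\<lambda>n x. P (Suc n) (pvar j * x))"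
  "qd_zero P j = graded_map (\<lambda>n x. P n (pvar j * x))"
  "qd_minus P j = graded_map (\<lambda>n x. case n of 0 \<Rightarrow> 0 | Suc k \<Rightarrow> P k (pvar j * x))"
  by (auto simp: fun_eq_iff graded_map_def qd_plus_def qd_zero_def qd_minus_def)

lemma linear_P_pvar: "Vector_Spaces.linear pscale pscale (\<lambda>x. P n (pvar j * x))"
  using Vector_Spaces.linear_compose[OF linear_pvar linear_P] by (simp add: o_def)

lemma linear_qd:
  "Vector_Spaces.linear pscale pscale (qd_plus P j)"
  "Vector_Spaces.linear pscale pscale (qd_zero P j)"
  "Vector_Spaces.linear pscale pscale (qd_minus P j)"
proof -
  have "Vector_Spaces.linear pscale pscale (\<lambda>x. case n of 0 \<Rightarrow> 0 | Suc k \<Rightarrow> P k (pvar j * x))" for n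
    using linear_P_pvar by (cases n) (simp_all add: Vector_Spaces.linear_iff)
  then show "Vector_Spaces.linear pscale pscale (qd_minus P j)"
    unfolding qd_eq_graded_map by (rule linear_graded_map)
qed (auto simp: qd_eq_graded_map intro!: linear_graded_map linear_P_pvar)

lemma qd_homogeneous:
  assumes "P n x = x"
  shows "qd_plus P j x = P (Suc n) (pvar j * x)"
    "qd_zero P j x = P n (pvar j * x)"
    "qd_minus P j x = (case n of 0 \<Rightarrow> 0 | Suc k \<Rightarrow> P k (pvar j * x))"
  unfolding qd_eq_graded_map
  by (subst graded_map_homogeneous[OF _ assms]; simp add: P_zero split: nat.split)+

text \<open>For \<open>n = 0\<close> the truncated index \<open>n - 1\<close> is \<open>0\<close>,
  and the third claim concerns the zero vector.\<close>

lemma qd_grade: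
  assumes "P n x = x"
  shows "P (Suc n) (qd_plus P j x) = qd_plus P j x" "P n (qd_zero P j x) = qd_zero P j x"
    "P (n - 1) (qd_minus P j x) = qd_minus P j x"
  unfolding qd_homogeneous[OF assms] by (simp_all add: P_idem P_zero split: nat.split)

lemma qd_real:
  assumes "x \<in> real_polys"
  shows "qd_plus P j x \<in> real_polys" "qd_zero P j x \<in> real_polys" "qd_minus P j x \<in> real_polys"
  unfolding qd_plus_def qd_zero_def qd_minus_def using assms
  by (auto intro!: real_polys_sum P_real real_polys_mult real_polys_pvar real_polys_0 split: nat.split)

lemma is_adjoint_homogeneous:
  assumes "Vector_Spaces.linear pscale pscale A" "Vector_Spaces.linear pscale pscale B"
    and hom: "\<And>n k x y. P n x = x \<Longrightarrow> P k y = y \<Longrightarrow> ip S (A x) y = ip S x (B y)"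
  shows "is_adjoint S S A B"
proof -
  have 1: "ip S (A x) y = ip S x (B y)" if "P n x = x" for n x y
    by (induction y rule: graded_induct)
      (simp_all add: hom[OF that] sp.ip_add_right lin_add[OF assms(2)])
  have "ip S (A x) y = ip S x (B y)" for x y
    by (induction x rule: graded_induct) (simp_all add: 1 sp.ip_add_left lin_add[OF assms(1)])
  then show ?thesis using assms(1,2) by (simp add: is_adjoint_def)
qed

lemma ip_P_pvar: "ip S (P n (pvar j * x)) y = ip S x (pvar j * P n y)"
  by (simp add: ip_P ip_pvar)

lemma P_of_homogeneous: "P k y = y \<Longrightarrow> P n y = (if n = k then y else 0)"
  using P_orth[of n k y] by auto

lemma ip_homogeneous: "P n x = x \<Longrightarrow> ip S x y = ip S x (P n y)"
  using ip_P by metis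

text \<open>For \<open>x\<close> of degree \<open>n\<close> and \<open>y\<close> of degree
  \<open>k\<close>, both sides equal \<open>ip S x (pvar j * y)\<close> if \<open>k = Suc n\<close>
  and vanish otherwise.\<close>

lemma adjoint_qd_plus: "is_adjoint S S (qd_plus P j) (qd_minus P j)"
proof (rule is_adjoint_homogeneous)
  fix n k x y assume x: "P n x = x" and y: "P k y = y"
  show "ip S (qd_plus P j x) y = ip S x (qd_minus P j y)"
  proof (cases k)
    case 0
    then show ?thesis
      by (simp add: qd_homogeneous[OF x] qd_homogeneous[OF y] ip_P_pvar P_of_homogeneous[OF y] sp.ip_zero_right)
  next
    case (Suc i)
    have "ip S x (P i (pvar j * y)) = ip S x (P n (P i (pvar j * y)))" by (rule ip_homogeneous[OF x])
    also have "\<dots> = (if n = i then ip S x (pvar j * y) else 0)"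
      using P_orth[of n i] ip_homogeneous[OF x, of "pvar j * y"] by (simp add: P_idem sp.ip_zero_right)
    finally show ?thesis
      by (simp add: qd_homogeneous[OF x] qd_homogeneous[OF y] ip_P_pvar P_of_homogeneous[OF y] sp.ip_zero_right Suc)
  qed
qed (rule linear_qd)+

lemma self_adjoint_qd_zero: "self_adjoint S (qd_zero P j)"
proof (rule is_adjoint_homogeneous)
  fix n k x y assume x: "P n x = x" and y: "P k y = y"
  have "ip S x (P k (pvar j * y)) = ip S x (P n (P k (pvar j * y)))" by (rule ip_homogeneous[OF x])
  also have "\<dots> = (if n = k then ip S x (pvar j * y) else 0)"
    using P_orth[of n k] ip_homogeneous[OF x, of "pvar j * y"] by (simp add: P_idem sp.ip_zero_right)
  finally show "ip S (qd_zero P j x) y = ip S x (qd_zero P j y)"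
    by (simp add: qd_homogeneous[OF x] qd_homogeneous[OF y] ip_P_pvar P_of_homogeneous[OF y] sp.ip_zero_right)
qed (rule linear_qd)+

text \<open>The three-term property. Tested against \<open>z\<close>, the vector is paired through
  \<open>x\<close> with \<open>pvar j * P i z\<close>, whose degree is below \<open>n\<close>.
  Orthogonality to every \<open>z\<close> yields norm zero, not the zero vector.\<close>

lemma null_P_pvar:
  assumes x: "P n x = x" and "Suc i < n"
  shows "null_vec S (P i (pvar j * x))"
proof -
  have "ip S (P i (pvar j * x)) z = 0" for z
  proof -
    have "pvar j * P i z \<in> deg_lt (Suc (Suc i))" by (intro pvar_deg_lt P_deg)
    then have "P n (pvar j * P i z) = 0" using assms(2) by (intro P_eq_0) auto
    then show ?thesis
      using ip_homogeneous[OF x, of "pvar j * P i z"] by (simp add: ip_P_pvar sp.ip_zero_right)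
  qed
  then show ?thesis by (simp add: null_vec_def)
qed

text \<open>For \<open>x\<close> of degree \<open>n\<close> the product has components of degree at
  most \<open>Suc n\<close>; the top three are the decomposition, and the others have zero
  norm.\<close>

lemma pvar_decomposition:
  "null_vec S (pvar j * x - (qd_plus P j x + qd_zero P j x + qd_minus P j x))"
proof (induction x rule: graded_induct)
  case (homogeneous n x)
  have "x \<in> deg_lt (Suc n)" using P_deg[of n x] homogeneous by simp
  then have "pvar j * x = (\<Sum>k<Suc (Suc n). P k (pvar j * x))"
    by (rule sum_P[OF pvar_deg_lt, symmetric])
  also have "\<dots> = (\<Sum>k<n. P k (pvar j * x)) + P n (pvar j * x) + P (Suc n) (pvar j * x)"
    by simp
  \<comment> \<open>For \<open>n = 0\<close> both sums are empty and \<open>qd_minus P j x\<close>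
    is zero.\<close>
  also have "(\<Sum>k<n. P k (pvar j * x)) = (\<Sum>k<n - 1. P k (pvar j * x)) + qd_minus P j x"
    by (simp add: qd_homogeneous[OF homogeneous] split: nat.split)
  finally have "pvar j * x - (qd_plus P j x + qd_zero P j x + qd_minus P j x) = (\<Sum>k<n - 1. P k (pvar j * x))"
    unfolding qd_homogeneous(1,2)[OF homogeneous] diff_eq_eq by (simp only: ac_simps)
  moreover have "null_vec S (\<Sum>k<n - 1. P k (pvar j * x))"
    using sp.subspace_sum[OF sp.subspace_null, of "{..<n - 1}" "\<lambda>k. P k (pvar j * x)"]
      null_P_pvar[OF homogeneous] by auto
  ultimately show ?case by simp
next
  case (add x y)
  from sp.null_add[OF this] show ?case
    by (simp add: distrib_left lin_add[OF linear_qd(1)] lin_add[OF linear_qd(2)] lin_add[OF linear_qd(3)]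
        algebra_simps)
qed

text \<open>The leading part of \<open>p\<close> decides: the difference \<open>p - P n p\<close> has degree below \<open>n\<close>, so
  multiplied by \<open>X\<^sub>j\<close> it is killed by \<open>P (Suc n)\<close>.\<close>

lemma P_Suc_pvar_P:
  assumes "p \<in> deg_lt (Suc n)"
  shows "P (Suc n) (pvar j * P n p) = P (Suc n) (pvar j * p)"
proof -
  have "p = P_lt n p + P n p" using P_lt_id[OF assms] by (simp add: P_lt_def)
  then have "P (Suc n) (pvar j * p) = P (Suc n) (pvar j * P_lt n p) + P (Suc n) (pvar j * P n p)"
    by (metis P_add distrib_left)
  then show ?thesis using P_eq_0[OF pvar_deg_lt[OF P_lt_deg], of n "Suc n"] by simp
qed

lemma qd_plus_P_mon:
  assumes "mdeg m = n"
  shows "qd_plus P j (P n (mon m)) = P (Suc n) (mon (unit_exp j + m))"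
  using P_Suc_pvar_P[OF mon_deg_lt, of m n j] assms
  by (simp add: qd_homogeneous[OF P_idem] pvar_mon)

text \<open>On \<open>P n (mon m)\<close> both orders give the projection of one and the same
  monomial, so the creators commute exactly, as symmetry demands.\<close>

lemma qd_plus_commute: "qd_plus P j (qd_plus P k x) = qd_plus P k (qd_plus P j x)"
proof (rule linear_eq_on_P_mon[of pscale "\<lambda>x. qd_plus P j (qd_plus P k x)"])
  fix n and m :: "'a \<Rightarrow>\<^sub>0 nat" assume "mdeg m = n"
  moreover from this have "mdeg (unit_exp i + m) = Suc n" for i
    by (simp add: mdeg_add mdeg_unit_exp del: One_nat_def)
  ultimately show "qd_plus P j (qd_plus P k (P n (mon m))) = qd_plus P k (qd_plus P j (P n (mon m)))"
    by (simp add: qd_plus_P_mon add_ac del: One_nat_def)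
qed (use Vector_Spaces.linear_compose[OF linear_qd(1) linear_qd(1)] in \<open>simp_all add: o_def\<close>)

section \<open>Axioms of the interacting Fock space, real structure and cyclicity of the
  vacuum\<close>

abbreviation "F \<equiv> poly_ifs \<phi> P"

lemma poly_ifs_sel [simp]:
  "scl F = pscale" "ip F = ip S" "grade F = ortho_space P" "vac F = 1"
  "cre F v = (\<lambda>Q. \<Sum>j\<in>UNIV. pscale (v $ j) (qd_plus P j Q))"
  "ann F v = (\<lambda>Q. \<Sum>j\<in>UNIV. pscale (cnj (v $ j)) (qd_minus P j Q))"
  by (simp_all add: poly_ifs_def state_space_def)

lemma poly_ifs_pre [simp]: "null_vec F = null_vec S" "eq_mod_null F = eq_mod_null S"
  "is_adjoint F F = is_adjoint S S" "adjointable F F = adjointable S S" "pre_hilbert F = pre_hilbert S"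
  by (simp_all add: fun_eq_iff null_vec_def eq_mod_null_def is_adjoint_def adjointable_def pre_hilbert_def)

lemma sum_axis: "(\<Sum>i\<in>UNIV. pscale (axis j 1 $ i) (f i)) = f j"
  "(\<Sum>i\<in>UNIV. pscale (cnj (axis j 1 $ i)) (f i)) = f j"
proof -
  have "pscale (axis j 1 $ i) (f i) = (if i = j then f i else 0)"
    "pscale (cnj (axis j 1 $ i)) (f i) = (if i = j then f i else 0)" for i
    by (simp_all add: axis_def)
  then show "(\<Sum>i\<in>UNIV. pscale (axis j 1 $ i) (f i)) = f j"
    "(\<Sum>i\<in>UNIV. pscale (cnj (axis j 1 $ i)) (f i)) = f j" by simp_all
qed

lemma coord_poly_ifs: "coord F (qd_zero P) j = (\<lambda>x. qd_plus P j x + qd_zero P j x + qd_minus P j x)"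
  by (simp add: coord_def sum_axis)

lemma direct_sum_ortho_space: "direct_sum pscale (ortho_space P)"
  unfolding direct_sum_def
proof (intro conjI allI)
  show "poly.subspace (ortho_space P n)" for n by (simp add: ortho_space_P_lt)
  fix x :: "'a cpoly"
  obtain N where N: "x \<in> deg_lt N" using deg_lt_exists by blast
  show "\<exists>!f. (\<forall>n. f n \<in> ortho_space P n) \<and> finite {n. f n \<noteq> 0} \<and> x = (\<Sum>n | f n \<noteq> 0. f n)"
  proof (rule ex1I[of _ "\<lambda>n. P n x"]; (elim conjE)?)
    have "(\<Sum>n | P n x \<noteq> 0. P n x) = (\<Sum>n<N. P n x)"
      using P_support[OF N] by (intro sum.mono_neutral_left) auto
    moreover have "P n x \<in> ortho_space P n" for n
      by (simp add: P_fixed_iff[symmetric] P_idem)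
    ultimately show "(\<forall>n. P n x \<in> ortho_space P n) \<and> finite {n. P n x \<noteq> 0} \<and> x = (\<Sum>n | P n x \<noteq> 0. P n x)"
      using P_support[OF N] sum_P[OF N] by (auto intro: finite_subset)
  next
    fix f assume f: "\<forall>n. f n \<in> ortho_space P n" "finite {n. f n \<noteq> 0}" "x = (\<Sum>n | f n \<noteq> 0. f n)"
    have "P n x = f n" for n
    proof -
      have "P n x = (\<Sum>k | f k \<noteq> 0. if n = k then f k else 0)"
        unfolding f(3) P_sum
        by (intro sum.cong refl) (use f(1) P_of_homogeneous P_fixed_iff in metis)
      then show ?thesis using f(2) by (simp add: sum.delta)
    qed
    then show "f = (\<lambda>n. P n x)" by auto
  qed
qed

lemma creator_adjoint: "is_adjoint S S (cre F v) (ann F v)"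
proof -
  note q = lin_add[OF linear_qd(1)] lin_add[OF linear_qd(3)] lin_scale[OF linear_qd(1)] lin_scale[OF linear_qd(3)]
  have "ip S (qd_plus P j x) y = ip S x (qd_minus P j y)" for j x y
    using adjoint_qd_plus by (simp add: is_adjoint_def)
  then show ?thesis
    unfolding is_adjoint_def poly_ifs_sel scl_state_space Vector_Spaces.linear_iff
    by (simp add: poly.vector_space_axioms q poly.scale_right_distrib sum.distrib poly.scale_sum_right
        mult.commute sp.ip_sum_left sp.ip_sum_right ip_pscale_left ip_pscale_right)
qed

text \<open>Peeling one unit off the exponent exhibits each spanning vector
  \<open>P (Suc n) (mon m)\<close> as the image of a vector of degree \<open>n\<close> under a basis
  creator.\<close>

lemma ortho_space_Suc_creators: "ortho_space P (Suc n) = poly.span (\<Union>v. cre F v ` ortho_space P n)"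
proof (rule equalityI)
  have sub: "poly.subspace (ortho_space P (Suc n))" by (simp add: ortho_space_P_lt)
  have "qd_plus P j x \<in> ortho_space P (Suc n)" if "x \<in> ortho_space P n" for j x
    using that qd_grade(1)[of n x j] by (simp add: P_fixed_iff)
  then have "(\<Union>v. cre F v ` ortho_space P n) \<subseteq> ortho_space P (Suc n)"
    by (auto intro!: poly.subspace_sum[OF sub] poly.subspace_scale[OF sub])
  then show "poly.span (\<Union>v. cre F v ` ortho_space P n) \<subseteq> ortho_space P (Suc n)"
    using sub by (rule poly.span_minimal)
  have "P (Suc n) (mon m) \<in> (\<Union>v. cre F v ` ortho_space P n)" if m: "mdeg m = Suc n" for m
  proof -
    obtain j m' where m': "m = unit_exp j + m'" "mdeg m' = n" using exponent_Suc[OF m] by metis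
    have "P (Suc n) (mon m) = cre F (axis j 1) (P n (mon m'))"
      using qd_plus_P_mon[OF m'(2)] m'(1) by (simp add: sum_axis)
    then show ?thesis using range_P by blast
  qed
  then show "ortho_space P (Suc n) \<subseteq> poly.span (\<Union>v. cre F v ` ortho_space P n)"
    unfolding ortho_space_P_mon[of "Suc n"] by (intro poly.span_mono) auto
qed

theorem symmetric_ifs_poly_ifs: "symmetric_ifs (*s) F"
  unfolding symmetric_ifs_def is_ifs_def
proof (intro conjI allI impI)
  show "vector_space ((*s) :: complex \<Rightarrow> complex ^ 'a \<Rightarrow> _)" by (rule vec.vector_space_axioms)
  show "pre_hilbert F" using sp.pre_hilbert by simp
  show "direct_sum (scl F) (grade F)" using direct_sum_ortho_space by simp
  show "ip F x y = 0" if "m \<noteq> n" "x \<in> grade F m" "y \<in> grade F n" for m n x y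
    using that ip_homogeneous[of m x y] P_of_homogeneous[of n y m]
    by (simp add: P_fixed_iff sp.ip_zero_right)
  show "ip F (vac F) (vac F) = 1" by (simp add: ip_state_space pstar_1 state_1)
  show "cre F v \<in> adjointable F F" for v using sp.is_adjoint_adjointable[OF creator_adjoint] by simp
  show "cre F (u + v) x = cre F u x + cre F v x" for u v x
    by (simp add: poly.scale_left_distrib sum.distrib)
  show "cre F (c *s v) x = scl F c (cre F v x)" for c v x
    by (simp add: poly.scale_sum_right)
  show "grade F (Suc n) = module.span (scl F) (\<Union>v. cre F v ` grade F n)" for n
    unfolding poly_ifs_sel(1,3) by (rule ortho_space_Suc_creators)
  show "cre F v ` grade F n \<subseteq> grade F (Suc n)" for v n
    unfolding poly_ifs_sel(3) ortho_space_Suc_creators by (auto intro!: poly.span_base)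
  show "is_adjoint F F (cre F v) (ann F v)" for v using creator_adjoint[of v] by simp
  \<comment> \<open>The vacuum is homogeneous of degree \<open>0\<close>, where
    \<open>qd_minus\<close> takes its default value \<open>0\<close>.\<close>
  have "P 0 1 = 1" by (simp add: P_0 state_1)
  then show "ann F v (vac F) = 0" for v by (simp add: qd_homogeneous)
  show "cre F u \<circ> cre F v = cre F v \<circ> cre F u" for u v
  proof
    fix x
    have "cre F u (cre F v x) = (\<Sum>j\<in>UNIV. \<Sum>k\<in>UNIV. pscale (u $ j * v $ k) (qd_plus P j (qd_plus P k x)))" for u v
      by (simp add: lin_sum[OF linear_qd(1)] lin_scale[OF linear_qd(1)] poly.scale_sum_right)
    note this[of u v] also have "(\<Sum>j\<in>UNIV. \<Sum>k\<in>UNIV. pscale (u $ j * v $ k) (qd_plus P j (qd_plus P k x))) =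
      (\<Sum>k\<in>UNIV. \<Sum>j\<in>UNIV. pscale (v $ k * u $ j) (qd_plus P k (qd_plus P j x)))"
      by (subst sum.swap) (simp add: qd_plus_commute mult.commute)
    finally show "(cre F u \<circ> cre F v) x = (cre F v \<circ> cre F u) x"
      using \<open>\<And>v u. cre F u (cre F v x) = _ v u\<close> by simp
  qed
qed simp_all

lemma real_structure_cond_poly_ifs: "real_structure_cond F (qd_zero P) real_polys"
  unfolding real_structure_cond_def
proof (intro conjI allI ballI)
  show "ip F x y \<in> \<real>" if "x \<in> real_polys" "y \<in> real_polys" for x y using that by (simp add: ip_real)
  show "gradation_preserving F (qd_zero P j)" for j
    unfolding gradation_preserving_def using qd_grade(2) by (auto simp: P_fixed_iff)
  show "self_adjoint F (qd_zero P j)" for j by (simp add: self_adjoint_qd_zero)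
  show "cre F (axis j 1) ` real_polys \<subseteq> real_polys" "qd_zero P j ` real_polys \<subseteq> real_polys"
    "ann F (axis j 1) ` real_polys \<subseteq> real_polys" for j
    by (auto simp: sum_axis qd_real)
  show "coord_commute F (qd_zero P)"
    unfolding coord_commute_def eq_mod_null_def
  proof (intro allI)
    fix j k x
    define Y where "Y j = coord F (qd_zero P) j" for j
    have XY: "ip S (Y j x) z = ip S (pvar j * x) z" for j x z
      using pvar_decomposition[of j x] by (simp add: Y_def coord_poly_ifs sp.null_diff_iff_left)
    have YX: "ip S z (Y j x) = ip S (pvar j * z) x" for j x z
      using XY sp.ip_commute ip_pvar by metis
    \<comment> \<open>The outer \<open>Y j\<close> is replaced by multiplication and moved to
      \<open>z\<close>; only then is \<open>Y k\<close> exposed to the same replacement.\<close>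
    have "ip S (Y j (Y k x)) z = ip S x (pvar k * (pvar j * z))" for j k z
      by (simp add: XY ip_pvar)
    then have "null_vec S (Y j (Y k x) - Y k (Y j x))"
      by (simp add: sp.null_diff_iff_left mult.left_commute)
    then show "null_vec F ((coord F (qd_zero P) j \<circ> coord F (qd_zero P) k) x - (coord F (qd_zero P) k \<circ> coord F (qd_zero P) j) x)"
      by (simp add: Y_def)
  qed
qed

text \<open>The algebra is generated by \<open>coord\<close>, which is multiplication by
  \<open>pvar j\<close> only modulo zero-norm vectors, so \<open>p * 1 = p\<close> proves nothing
  here. Instead, by induction on the degree, the creator part is recovered from \<open>coord\<close>
  by subtracting parts of lower degree that are already reached.\<close>

lemma vacuum_cyclic_poly_ifs: "vacuum_cyclic F (qd_zero P)"
proof -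
  define C where "C = (\<lambda>A. A (1 :: 'a cpoly)) ` op_algebra pscale UNIV (range (coord F (qd_zero P)))"
  have C_add: "x + y \<in> C" if "x \<in> C" "y \<in> C" for x y
    using that by (auto simp: C_def intro!: image_eqI[OF _ op_algebra.add])
  have C_scale: "pscale c x \<in> C" if "x \<in> C" for c x
    using that by (auto simp: C_def intro!: image_eqI[OF _ op_algebra.scale])
  have C_1: "1 \<in> C" unfolding C_def by (intro image_eqI[OF _ op_algebra.one]) simp
  have sub: "poly.subspace C"
    using C_add C_scale C_scale[OF C_1, of 0] by (intro poly.subspaceI) simp_all
  have C_coord: "coord F (qd_zero P) j x \<in> C" if x: "x \<in> C" for j x
  proof -
    obtain A where "A \<in> op_algebra pscale UNIV (range (coord F (qd_zero P)))" "x = A 1"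
      using x unfolding C_def by blast
    then show ?thesis
      unfolding C_def
      by (intro image_eqI[of _ _ "coord F (qd_zero P) j \<circ> A"] op_algebra.comp[OF op_algebra.gen]) auto
  qed
  have hom: "x \<in> C" if "P n x = x" for n x
    using that
  proof (induction n arbitrary: x rule: less_induct)
    case (less n)
    show ?case
    proof (cases n)
      case 0
      then have "x \<in> poly.span {1}" using less(2) by (simp add: P_fixed_iff)
      then show ?thesis using C_1 poly.span_minimal[of "{1}" C] sub by blast
    next
      case (Suc k)
      have "P n (mon m) \<in> C" if m: "mdeg m = n" for m
      proof -
        obtain j m' where m': "m = unit_exp j + m'" "mdeg m' = k" using exponent_Suc[of m k] m Suc by metis
        define y where "y = P k (mon m')"
        have y: "P k y = y" by (simp add: y_def P_idem)
        have "P n (mon m) = coord F (qd_zero P) j y - qd_zero P j y - qd_minus P j y"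
          using qd_plus_P_mon[OF m'(2)] by (simp add: coord_poly_ifs m'(1) Suc y_def)
        moreover have "y \<in> C" "qd_zero P j y \<in> C" "qd_minus P j y \<in> C"
          using less(1)[of k] less(1)[of "k - 1"] y qd_grade(2,3)[OF y] Suc by auto
        ultimately show ?thesis using C_coord by (simp add: poly.subspace_diff[OF sub])
      qed
      then have "ortho_space P n \<subseteq> C"
        unfolding ortho_space_P_mon using sub by (intro poly.span_minimal) auto
      then show ?thesis using less(2) P_fixed_iff by blast
    qed
  qed
  have "x \<in> C" for x by (induction x rule: graded_induct) (auto intro: hom C_add)
  then show ?thesis by (auto simp: vacuum_cyclic_def C_def)
qed

lemma quantum_decomposition: "is_quantum_decomposition \<phi> P j (qd_plus P j) (qd_zero P j) (qd_minus P j)"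
  by (simp add: is_quantum_decomposition_def eq_mod_null_def pvar_decomposition sp.null_zero)

lemma pvar_eq_coord: "eq_mod_null S ((*) (pvar j)) (coord F (qd_zero P) j)"
  by (simp add: eq_mod_null_def coord_poly_ifs pvar_decomposition)

end

section \<open>Symmetric interacting Fock spaces with commuting coordinates\<close>

text \<open>The relation \<open>r\<close> is equality or equality up to zero-norm vectors.\<close>

lemma op_monomial_fun_upd_Suc:
  fixes X :: "'d::{finite,linorder} \<Rightarrow> 'h \<Rightarrow> 'h"
  assumes "reflp r" "transp r"
    and resp: "\<And>j x y. r x y \<Longrightarrow> r (X j x) (X j y)"
    and comm: "\<And>j k x. r (X j (X k x)) (X k (X j x))"
  shows "r (op_monomial X (n(j := Suc (n j))) x) (X j (op_monomial X n x))"
proof -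
  have refl: "r x x" for x using assms(1) by (auto dest: reflpD)
  have trans: "r x z" if "r x y" "r y z" for x y z using assms(2) that by (auto dest: transpD)
  have resp_power: "r ((X k ^^ i) x) ((X k ^^ i) y)" if "r x y" for k i x y
    by (induction i) (simp_all add: that resp)
  have comm_power: "r ((X k ^^ i) (X j x)) (X j ((X k ^^ i) x))" for k i x
  proof (induction i)
    case (Suc i)
    show ?case using trans[OF resp[OF Suc, of k] comm] by simp
  qed (simp add: refl)
  \<comment> \<open>Partial products make an induction over lists possible: factors after
    \<open>j\<close> keep their exponents (\<open>out\<close>), and the extra \<open>X j\<close> is
    pulled out past the powers before it (\<open>comm_power\<close>).\<close>
  define f where "f n js = foldr (\<lambda>k A. (X k ^^ n k) \<circ> A) js id" for n :: "'d \<Rightarrow> nat" and js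
  have f_Nil: "f n [] y = y" and f_Cons: "f n (k # js) y = (X k ^^ n k) (f n js y)" for n k js y
    by (simp_all add: f_def)
  define n' where "n' = n(j := Suc (n j))"
  have n': "n' j = Suc (n j)" "k \<noteq> j \<Longrightarrow> n' k = n k" for k by (simp_all add: n'_def)
  have out: "f n' js y = f n js y" if "j \<notin> set js" for js y
    using that
  proof (induction js)
    case (Cons k js)
    moreover from Cons.prems have "n' k = n k" by (intro n'(2)) auto
    ultimately show ?case by (simp add: f_Cons)
  qed (simp add: f_Nil)
  have "r (f n' js x) (X j (f n js x))" if "distinct js" "j \<in> set js" for js
    using that
  proof (induction js)
    case (Cons k js)
    show ?case
    proof (cases "k = j")
      case True
      then show ?thesis using Cons.prems out by (simp add: f_Cons refl n'(1))
    next
      case False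
      then have "r (f n' js x) (X j (f n js x))" using Cons by simp
      from trans[OF resp_power[OF this] comm_power] False show ?thesis by (simp add: f_Cons n'(2))
    qed
  qed simp
  then show ?thesis unfolding op_monomial_def f_def[symmetric] n'_def[symmetric] by simp
qed

lemma op_monomial_0: "op_monomial X (Poly_Mapping.lookup 0) = id"
proof -
  have "foldr (\<lambda>j A. (X j ^^ 0) \<circ> A) js id = id" for js by (induction js) auto
  then show ?thesis by (simp add: op_monomial_def)
qed

lemma op_monomial_closed:
  assumes "\<And>j x. x \<in> R \<Longrightarrow> X j x \<in> R" "x \<in> R"
  shows "op_monomial X n x \<in> R"
proof -
  have pow: "(X j ^^ i) x \<in> R" if "x \<in> R" for j i x
    by (induction i) (simp_all add: that assms(1))
  have "foldr (\<lambda>j A. (X j ^^ n j) \<circ> A) js id x \<in> R" for js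
    by (induction js) (simp_all add: pow assms(2))
  then show ?thesis by (simp add: op_monomial_def)
qed

lemma lookup_unit_exp_add:
  "Poly_Mapping.lookup (unit_exp j + m) = (Poly_Mapping.lookup m)(j := Suc (Poly_Mapping.lookup m j))"
  by (auto simp: fun_eq_iff lookup_add lookup_single when_def)

locale fock =
  fixes G :: "(complex ^ 'a::{finite,linorder}, 'h::ab_group_add) ifs" and a0 :: "'a \<Rightarrow> 'h \<Rightarrow> 'h"
  assumes symmetric: "symmetric_ifs (*s) G"
    and real_structure: "real_structure_cond G a0 (real_vectors G a0)"
begin

abbreviation "C j \<equiv> cre G (axis j 1)"
abbreviation "A j \<equiv> ann G (axis j 1)"
abbreviation "Y j \<equiv> coord G a0 j"
abbreviation "R \<equiv> real_vectors G a0"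

lemma is_ifs: "is_ifs (*s) G"
  using symmetric by (simp add: symmetric_ifs_def)

sublocale fs: prehilbert_space G
  using is_ifs unfolding is_ifs_def prehilbert_space_def by (elim conjE) assumption

lemma ifs_conditions:
  shows "direct_sum (scl G) (grade G)"
    "\<forall>m n x y. m \<noteq> n \<longrightarrow> x \<in> grade G m \<longrightarrow> y \<in> grade G n \<longrightarrow> ip G x y = 0"
    "grade G 0 = fs.span {vac G}" "ip G (vac G) (vac G) = 1"
    "\<forall>v n. cre G v ` grade G n \<subseteq> grade G (Suc n)"
    "\<forall>n. grade G (Suc n) = fs.span (\<Union>v. cre G v ` grade G n)"
    "\<forall>v. is_adjoint G G (cre G v) (ann G v) \<and> ann G v (vac G) = 0"
    "\<forall>u v x. cre G (u + v) x = cre G u x + cre G v x"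
    "\<forall>c v x. cre G (c *s v) x = scl G c (cre G v x)"
  using is_ifs unfolding is_ifs_def by - (elim conjE, assumption)+

lemmas grade_direct_sum = ifs_conditions(1)
  and grade_0 = ifs_conditions(3)
  and ip_vac = ifs_conditions(4)
  and grade_Suc = ifs_conditions(6)[rule_format]
  and cre_add = ifs_conditions(8)[rule_format]
  and cre_scale = ifs_conditions(9)[rule_format]

lemma grade_orth: "m \<noteq> n \<Longrightarrow> x \<in> grade G m \<Longrightarrow> y \<in> grade G n \<Longrightarrow> ip G x y = 0"
  using ifs_conditions(2) by blast

lemma cre_grade: "x \<in> grade G n \<Longrightarrow> cre G v x \<in> grade G (Suc n)"
  using ifs_conditions(5) by blast

lemma adjoint_cre: "is_adjoint G G (cre G v) (ann G v)"
  using ifs_conditions(7) by blast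

lemma cre_commute: "cre G u (cre G v x) = cre G v (cre G u x)"
  using symmetric by (simp add: symmetric_ifs_def fun_eq_iff)

lemma real_structure_conditions:
  shows "\<forall>x\<in>R. \<forall>y\<in>R. ip G x y \<in> \<real>" "\<forall>j. gradation_preserving G (a0 j) \<and> self_adjoint G (a0 j)"
    "\<forall>j. C j ` R \<subseteq> R \<and> a0 j ` R \<subseteq> R \<and> A j ` R \<subseteq> R" "coord_commute G a0"
  using real_structure unfolding real_structure_cond_def by - (elim conjE, assumption)+

lemma ip_R: "x \<in> R \<Longrightarrow> y \<in> R \<Longrightarrow> ip G x y \<in> \<real>"
  using real_structure_conditions(1) by blast

lemma a0_grade: "x \<in> grade G n \<Longrightarrow> a0 j x \<in> grade G n"
  using real_structure_conditions(2) unfolding gradation_preserving_def by blast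

lemma self_adjoint_a0: "self_adjoint G (a0 j)"
  using real_structure_conditions(2) by blast

lemma C_R: "x \<in> R \<Longrightarrow> C j x \<in> R"
  using real_structure_conditions(3) by blast

lemma linear_cre: "Vector_Spaces.linear (scl G) (scl G) (cre G v)"
  and linear_ann: "Vector_Spaces.linear (scl G) (scl G) (ann G v)"
  and linear_a0: "Vector_Spaces.linear (scl G) (scl G) (a0 j)"
  using adjoint_cre self_adjoint_a0 by (simp_all add: is_adjoint_def)

lemma Y_eq: "Y j x = C j x + (a0 j x + A j x)"
  by (simp add: coord_def add.assoc)

lemma self_adjoint_Y: "self_adjoint G (Y j)"
proof -
  have "ip G (C j x) y = ip G x (A j y)" "ip G (A j x) y = ip G x (C j y)" "ip G (a0 j x) y = ip G x (a0 j y)" for x y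
    using adjoint_cre fs.is_adjoint_sym[OF adjoint_cre] self_adjoint_a0 by (simp_all add: is_adjoint_def)
  moreover have "Vector_Spaces.linear (scl G) (scl G) (Y j)"
    unfolding Y_eq[abs_def] by (intro lin_plus linear_cre linear_ann linear_a0)
  ultimately show ?thesis
    by (simp add: is_adjoint_def Y_eq fs.ip_add_left fs.ip_add_right)
qed

lemma linear_Y: "Vector_Spaces.linear (scl G) (scl G) (Y j)"
  and ip_Y: "ip G (Y j x) y = ip G x (Y j y)"
  using self_adjoint_Y by (simp_all add: is_adjoint_def)

lemma cre_expand: "cre G v x = (\<Sum>j\<in>UNIV. scl G (v $ j) (C j x))"
proof -
  have "cre G 0 x = 0" using cre_add[of 0 0 x] by simp
  then have "cre G (\<Sum>j\<in>B. f j) x = (\<Sum>j\<in>B. cre G (f j) x)" for f and B :: "'a set"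
    by (induction B rule: infinite_finite_induct) (simp_all add: cre_add)
  from this[of "\<lambda>j. v $ j *s axis j 1" UNIV] show ?thesis
    by (simp add: basis_expansion cre_scale)
qed

section \<open>Monomials in creators and coordinates, and evaluation of polynomials at the
  vacuum\<close>

definition Cmon :: "('a \<Rightarrow>\<^sub>0 nat) \<Rightarrow> 'h" where
  "Cmon m = op_monomial C (Poly_Mapping.lookup m) (vac G)"

text \<open>Creators commute exactly, but coordinates only modulo zero-norm vectors; so the fixed
  order of factors in \<open>op_monomial\<close> matters here.\<close>

definition Ymon :: "('a \<Rightarrow>\<^sub>0 nat) \<Rightarrow> 'h" where
  "Ymon m = op_monomial Y (Poly_Mapping.lookup m) (vac G)"

lemma Cmon_0: "Cmon 0 = vac G" and Ymon_0: "Ymon 0 = vac G"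
  by (simp_all only: Cmon_def Ymon_def op_monomial_0 id_apply)

lemma Cmon_add: "Cmon (unit_exp j + m) = C j (Cmon m)"
  unfolding Cmon_def lookup_unit_exp_add
  by (rule op_monomial_fun_upd_Suc) (auto simp: cre_commute intro: reflpI transpI)

lemma Ymon_add: "null_vec G (Ymon (unit_exp j + m) - Y j (Ymon m))"
  unfolding Ymon_def lookup_unit_exp_add
proof (rule op_monomial_fun_upd_Suc[where r = "\<lambda>x y. null_vec G (x - y)"])
  show "reflp (\<lambda>x y. null_vec G (x - y))" by (simp add: reflp_def fs.null_zero)
  show "transp (\<lambda>x y. null_vec G (x - y))" using fs.null_diff_trans by (rule transpI)
  show "null_vec G (Y j x - Y j y)" if "null_vec G (x - y)" for j x y
    using fs.is_adjoint_null_diff[OF self_adjoint_Y that] .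
  show "null_vec G (Y j (Y k x) - Y k (Y j x))" for j k x
    using real_structure_conditions(4) by (simp add: coord_commute_def eq_mod_null_def)
qed

lemma Cmon_grade: "Cmon m \<in> grade G (mdeg m)"
proof (induction m rule: exponent_induct)
  case zero
  have "mdeg (0 :: 'a \<Rightarrow>\<^sub>0 nat) = 0" by (simp add: mdeg_eq_0_iff)
  then show ?case by (simp add: Cmon_0 grade_0 fs.span_base)
next
  case (add j m)
  then show ?case
    unfolding Cmon_add mdeg_add mdeg_unit_exp by (simp add: cre_grade)
qed

text \<open>Defined by linear extension: as the coordinates commute only modulo zero-norm vectors,
  substituting them for the variables need not be an algebra homomorphism.\<close>

definition poly_vec :: "'a cpoly \<Rightarrow> 'h" where
  "poly_vec = lin_ext (scl G) Ymon"

lemma linear_poly_vec: "Vector_Spaces.linear pscale (scl G) poly_vec"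
  unfolding poly_vec_def by (rule linear_lin_ext) (rule fs.vector_space_axioms)

lemma poly_vec_mon: "poly_vec (mon m) = Ymon m"
  unfolding poly_vec_def by (rule lin_ext_mon) (rule fs.vector_space_axioms)

lemma poly_vec_1: "poly_vec 1 = vac G"
  using poly_vec_mon[of 0] by (simp add: Ymon_0)

text \<open>Composing with \<open>ip G z\<close> turns the claim into an equality of two linear
  functionals, which may be checked on monomials.\<close>

lemma poly_vec_pvar: "null_vec G (poly_vec (pvar j * p) - Y j (poly_vec p))"
  unfolding fs.null_diff_iff_right
proof
  fix z
  have "Vector_Spaces.linear pscale (*) (ip G z \<circ> (poly_vec \<circ> (*) (pvar j)))"
    "Vector_Spaces.linear pscale (*) (ip G z \<circ> (Y j \<circ> poly_vec))"
    by (rule Vector_Spaces.linear_compose[OF Vector_Spaces.linear_compose[OF linear_pvar linear_poly_vec] fs.linear_ip],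
        rule Vector_Spaces.linear_compose[OF Vector_Spaces.linear_compose[OF linear_poly_vec linear_Y] fs.linear_ip])
  then show "ip G z (poly_vec (pvar j * p)) = ip G z (Y j (poly_vec p))"
    using lin_eq_on_mon[of "(*)" "ip G z \<circ> (poly_vec \<circ> (*) (pvar j))" "ip G z \<circ> (Y j \<circ> poly_vec)" p] Ymon_add
    by (simp add: pvar_mon poly_vec_mon fs.null_diff_iff_right del: One_nat_def)
qed

lemma ip_poly_vec_mon: "ip G (poly_vec (mon m)) (poly_vec q) = ip G (vac G) (poly_vec (mon m * q))"
proof (induction m arbitrary: q rule: exponent_induct)
  case zero
  show ?case by (simp add: poly_vec_1)
next
  case (add j m)
  have "ip G (poly_vec (mon (unit_exp j + m))) (poly_vec q) = ip G (Y j (poly_vec (mon m))) (poly_vec q)"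
    using poly_vec_pvar[of j "mon m"] unfolding fs.null_diff_iff_left pvar_mon by blast
  also have "\<dots> = ip G (poly_vec (mon m)) (poly_vec (pvar j * q))"
    using poly_vec_pvar[of j q] unfolding fs.null_diff_iff_right ip_Y by simp
  also have "\<dots> = ip G (vac G) (poly_vec (mon m * (pvar j * q)))" by (rule add)
  also have "mon m * (pvar j * q) = pvar j * mon m * q"
    by (simp only: ac_simps)
  also have "pvar j * mon m = mon (unit_exp j + m)"
    by (rule pvar_mon)
  finally show ?case .
qed

text \<open>Antilinearity in \<open>p\<close> reduces this to monomials, which \<open>pstar\<close>
  fixes. For \<open>q = p\<close> the left side is a squared norm; this gives positivity of the
  expectation functional.\<close>

lemma ip_poly_vec: "ip G (poly_vec p) (poly_vec q) = ip G (vac G) (poly_vec (pstar p * q))"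
  by (induction p rule: poly_induct)
    (simp_all add: lin_0[OF linear_poly_vec] pstar_0 fs.ip_simps lin_add[OF linear_poly_vec]
      lin_scale[OF linear_poly_vec] ip_poly_vec_mon pstar_add pstar_pscale pstar_mon pscale_mult distrib_right)

subsection \<open>Real vectors\<close>

lemma R_vac: "vac G \<in> R"
  unfolding real_vectors_def by (rule image_eqI[OF _ op_algebra.one]) simp

lemma R_add: "x \<in> R \<Longrightarrow> y \<in> R \<Longrightarrow> x + y \<in> R"
  unfolding real_vectors_def by (auto intro!: image_eqI[OF _ op_algebra.add])

lemma R_scale: "c \<in> \<real> \<Longrightarrow> x \<in> R \<Longrightarrow> scl G c x \<in> R"
  unfolding real_vectors_def by (auto intro!: image_eqI[OF _ op_algebra.scale])

lemma R_0: "0 \<in> R"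
  using R_scale[OF _ R_vac, of 0] by simp

lemma R_sum: "(\<And>i. i \<in> B \<Longrightarrow> f i \<in> R) \<Longrightarrow> sum f B \<in> R"
  by (induction B rule: infinite_finite_induct) (simp_all add: R_0 R_add)

lemma R_Y:
  assumes "x \<in> R"
  shows "Y j x \<in> R"
proof -
  obtain B where "B \<in> op_algebra (scl G) \<real> (range Y)" "x = B (vac G)"
    using assms unfolding real_vectors_def by blast
  then show ?thesis
    unfolding real_vectors_def
    by (intro image_eqI[of _ _ "Y j \<circ> B"] op_algebra.comp[OF op_algebra.gen]) auto
qed

lemma R_induct [consumes 1, case_names vac add scale coord]:
  assumes "x \<in> R" and "T (vac G)" and "\<And>x y. T x \<Longrightarrow> T y \<Longrightarrow> T (x + y)"
    and "\<And>c x. c \<in> \<real> \<Longrightarrow> T x \<Longrightarrow> T (scl G c x)" and "\<And>j x. T x \<Longrightarrow> T (Y j x)"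
  shows "T x"
proof -
  obtain B where B: "B \<in> op_algebra (scl G) \<real> (range Y)" "x = B (vac G)"
    using assms(1) unfolding real_vectors_def by blast
  \<comment> \<open>The start vector is general, because in a composition the outer factor is not
    applied to the vacuum.\<close>
  have "T (B z)" if "T z" for z
    using B(1) that by (induction arbitrary: z) (auto intro: assms(3-5))
  then show ?thesis using assms(2) B(2) by blast
qed

lemma Ymon_R: "Ymon m \<in> R"
  unfolding Ymon_def by (rule op_monomial_closed) (auto intro: R_Y R_vac)

lemma Cmon_R: "Cmon m \<in> R"
  unfolding Cmon_def by (rule op_monomial_closed) (auto intro: C_R R_vac)

lemma poly_vec_R: "p \<in> real_polys \<Longrightarrow> poly_vec p \<in> R"
  unfolding poly_vec_def by (rule lin_ext_closed) (auto intro: R_0 R_add R_scale Ymon_R)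

lemma expectation_real: "ip G (vac G) (op_monomial Y n (vac G)) \<in> \<real>"
  by (intro ip_R R_vac op_monomial_closed) (auto intro: R_Y)

lemma expectation_poly_vec:
  assumes "Vector_Spaces.linear pscale (*) \<phi>"
    and "\<And>n. \<phi> (pmonomial n) = ip G (vac G) (op_monomial Y n (vac G))"
  shows "\<phi> p = ip G (vac G) (poly_vec p)"
proof -
  have "\<phi> p = (ip G (vac G) \<circ> poly_vec) p"
    using assms(1) Vector_Spaces.linear_compose[OF linear_poly_vec fs.linear_ip]
  proof (rule lin_eq_on_mon)
    fix m
    show "\<phi> (mon m) = (ip G (vac G) \<circ> poly_vec) (mon m)"
      using assms(2)[of "Poly_Mapping.lookup m"] by (simp add: pmonomial_lookup poly_vec_mon Ymon_def)
  qed
  then show ?thesis by simp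
qed

lemma state_exists_unique:
  "\<exists>!\<phi>. state \<phi> \<and> (\<forall>n. \<phi> (pmonomial n) = ip G (vac G) (op_monomial Y n (vac G)))"
proof (rule ex_ex1I)
  define \<phi> where "\<phi> = (\<lambda>p. ip G (vac G) (poly_vec p))"
  have "Vector_Spaces.linear pscale (*) \<phi>"
    using Vector_Spaces.linear_compose[OF linear_poly_vec fs.linear_ip] by (simp add: \<phi>_def o_def)
  moreover have "\<phi> (pstar p * p) \<in> \<real>\<^sub>\<ge>\<^sub>0" for p
    using fs.pre_hilbert unfolding \<phi>_def ip_poly_vec[symmetric] pre_hilbert_def by blast
  ultimately have "state \<phi>"
    unfolding state_def by (auto simp: \<phi>_def ip_R R_vac poly_vec_R poly_vec_1 ip_vac)
  moreover have "\<phi> (pmonomial n) = ip G (vac G) (op_monomial Y n (vac G))" for n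
    by (simp add: \<phi>_def pmonomial_eq poly_vec_mon Ymon_def lookup_Abs)
  ultimately show "\<exists>\<phi>. state \<phi> \<and> (\<forall>n. \<phi> (pmonomial n) = ip G (vac G) (op_monomial Y n (vac G)))" by blast
next
  fix \<phi> \<psi>
  assume "state \<phi> \<and> (\<forall>n. \<phi> (pmonomial n) = ip G (vac G) (op_monomial Y n (vac G)))"
    and "state \<psi> \<and> (\<forall>n. \<psi> (pmonomial n) = ip G (vac G) (op_monomial Y n (vac G)))"
  then have "\<phi> p = \<psi> p" for p
    using expectation_poly_vec[of \<phi> p] expectation_poly_vec[of \<psi> p] by (simp add: state_def)
  then show "\<phi> = \<psi>" by auto
qed

end

context fock
begin

subsection \<open>The filtration by the number of particles\<close>

text \<open>The index set is arbitrary, so that the lower part \<open>{..<n}\<close>, the upper part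
  \<open>{n..}\<close> and a single degree are treated alike.\<close>

definition comb :: "nat set \<Rightarrow> 'h set" where
  "comb B = fs.span (\<Union>k\<in>B. grade G k)"

lemma subspace_comb: "fs.subspace (comb B)"
  by (simp add: comb_def)

lemma grade_comb: "x \<in> grade G k \<Longrightarrow> k \<in> B \<Longrightarrow> x \<in> comb B"
  unfolding comb_def by (intro fs.span_base) blast

lemma comb_minimal: "(\<And>k x. k \<in> B \<Longrightarrow> x \<in> grade G k \<Longrightarrow> x \<in> T) \<Longrightarrow> fs.subspace T \<Longrightarrow> comb B \<subseteq> T"
  unfolding comb_def by (rule fs.span_minimal) auto

lemma comb_mono: "x \<in> comb B \<Longrightarrow> B \<subseteq> B' \<Longrightarrow> x \<in> comb B'"
  unfolding comb_def by (erule subsetD[OF fs.span_mono, rotated]) (rule UN_mono, simp_all)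

lemma comb_map:
  assumes "Vector_Spaces.linear (scl G) (scl G) f" "x \<in> comb B"
    and "\<And>k y. k \<in> B \<Longrightarrow> y \<in> grade G k \<Longrightarrow> f y \<in> comb B'"
  shows "f x \<in> comb B'"
proof -
  have "fs.subspace {x. f x \<in> comb B'}"
    using subspace_comb[of B'] assms(1)
    by (intro fs.subspaceI) (auto simp: lin_0 lin_add lin_scale fs.subspace_0 fs.subspace_add fs.subspace_scale)
  then have "comb B \<subseteq> {x. f x \<in> comb B'}" using assms(3) by (intro comb_minimal) simp_all
  then show ?thesis using assms(2) by auto
qed

lemma comb_orth:
  assumes "x \<in> comb B" "y \<in> comb B'" "B \<inter> B' = {}"
  shows "ip G x y = 0"
proof -
  have sub: "fs.subspace {y. ip G x y = 0}" "fs.subspace {x. ip G x y = 0}" for x y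
    by (auto intro!: fs.subspaceI simp: fs.ip_simps)
  have "comb B' \<subseteq> {y. ip G x y = 0}" if "k \<in> B" "x \<in> grade G k" for k x
  proof (intro comb_minimal sub)
    fix i y assume y: "i \<in> B'" "y \<in> grade G i"
    then have "k \<noteq> i" using that(1) assms(3) by blast
    then show "y \<in> {y. ip G x y = 0}" using grade_orth[OF _ that(2) y(2)] by simp
  qed
  then have "comb B \<subseteq> {x. ip G x y = 0}"
    using assms(2) by (intro comb_minimal sub) auto
  then show ?thesis using assms(1) by auto
qed

lemma comb_split: "\<exists>u\<in>comb {..<n}. \<exists>v\<in>comb {n..}. x = u + v"
proof -
  obtain f where f: "\<And>k. f k \<in> grade G k" "finite {k. f k \<noteq> 0}" "x = (\<Sum>k | f k \<noteq> 0. f k)"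
    using grade_direct_sum unfolding direct_sum_def by metis
  let ?K = "{k. f k \<noteq> 0}"
  have "x = (\<Sum>k\<in>?K \<inter> {..<n}. f k) + (\<Sum>k\<in>?K - {..<n}. f k)"
    using f(2,3) by (metis sum.Int_Diff)
  moreover have "(\<Sum>k\<in>?K \<inter> {..<n}. f k) \<in> comb {..<n}" "(\<Sum>k\<in>?K - {..<n}. f k) \<in> comb {n..}"
    by (intro fs.subspace_sum[OF subspace_comb] grade_comb[OF f(1)]; auto)+
  ultimately show ?thesis by blast
qed

text \<open>All zero-norm vectors are adjoined to each step, because the chosen annihilators may
  produce zero-norm components in any degree.\<close>

definition filt :: "nat \<Rightarrow> 'h set" where
  "filt n = {x. \<exists>u\<in>comb {..<n}. null_vec G (x - u)}"

lemma filtI: "u \<in> comb {..<n} \<Longrightarrow> null_vec G (x - u) \<Longrightarrow> x \<in> filt n"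
  by (auto simp: filt_def)

lemma subspace_filt: "fs.subspace (filt n)"
proof (rule fs.subspaceI)
  show "0 \<in> filt n"
    by (rule filtI[of 0]) (simp_all add: fs.subspace_0[OF subspace_comb] fs.null_zero)
next
  fix x y assume "x \<in> filt n" "y \<in> filt n"
  then obtain u v where uv: "u \<in> comb {..<n}" "v \<in> comb {..<n}" "null_vec G (x - u)" "null_vec G (y - v)"
    by (auto simp: filt_def)
  from fs.null_add[OF uv(3,4)] have "null_vec G (x + y - (u + v))" by (simp add: algebra_simps)
  with uv(1,2) show "x + y \<in> filt n" by (intro filtI[of "u + v"] fs.subspace_add[OF subspace_comb])
next
  fix c x assume "x \<in> filt n"
  then obtain u where u: "u \<in> comb {..<n}" "null_vec G (x - u)" by (auto simp: filt_def)
  from fs.null_scale[OF u(2)] have "null_vec G (scl G c x - scl G c u)"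
    by (simp add: fs.scale_right_diff_distrib)
  with u(1) show "scl G c x \<in> filt n"
    by (intro filtI[of "scl G c u"] fs.subspace_scale[OF subspace_comb])
qed

lemma filt_null: "y \<in> filt n \<Longrightarrow> null_vec G (x - y) \<Longrightarrow> x \<in> filt n"
  unfolding filt_def using fs.null_diff_trans by blast

lemma null_filt: "null_vec G x \<Longrightarrow> x \<in> filt n"
  using filt_null[OF fs.subspace_0[OF subspace_filt], of x] by simp

lemma filt_mono: "x \<in> filt m \<Longrightarrow> m \<le> n \<Longrightarrow> x \<in> filt n"
  unfolding filt_def using comb_mono[of _ "{..<m}" "{..<n}"] by auto

lemma comb_filt: "x \<in> comb {..<n} \<Longrightarrow> x \<in> filt n"
  by (rule filtI[of x]) (simp_all add: fs.null_zero)

lemma grade_filt: "x \<in> grade G k \<Longrightarrow> k < n \<Longrightarrow> x \<in> filt n"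
  by (intro comb_filt grade_comb) auto

lemma C_filt:
  assumes "x \<in> filt n"
  shows "C j x \<in> filt (Suc n)"
proof -
  obtain u where u: "u \<in> comb {..<n}" "null_vec G (x - u)" using assms by (auto simp: filt_def)
  have "C j u \<in> comb {..<Suc n}"
    by (rule comb_map[OF linear_cre u(1)]) (auto intro: grade_comb cre_grade)
  then show ?thesis using fs.is_adjoint_null_diff[OF adjoint_cre u(2)] by (rule filtI)
qed

text \<open>The fixed adjoint \<open>A j\<close> respects the filtration only up to zero-norm vectors: the part of
  \<open>A j u\<close> of high degree has norm zero.\<close>

lemma A_comb_filt:
  assumes u: "u \<in> comb {..<n}"
  shows "A j u \<in> filt n"
proof -
  obtain v w where vw: "v \<in> comb {..<n}" "w \<in> comb {n..}" "A j u = v + w"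
    using comb_split by blast
  have "C j w \<in> comb {Suc n..}"
    by (rule comb_map[OF linear_cre vw(2)]) (auto intro: grade_comb cre_grade)
  then have "ip G u (C j w) = 0" by (intro comb_orth[OF u]) auto
  moreover have "ip G (A j u) w = ip G u (C j w)"
    using fs.is_adjoint_sym[OF adjoint_cre] by (simp add: is_adjoint_def)
  moreover have "ip G v w = 0" by (intro comb_orth[OF vw(1,2)]) auto
  ultimately have "null_vec G w" by (simp add: vw(3) fs.ip_add_left null_vec_def)
  then show ?thesis using vw(1,3) by (intro filtI[of v]) simp_all
qed

lemma lower_filt:
  assumes "x \<in> filt n"
  shows "a0 j x + A j x \<in> filt n"
proof -
  obtain u where u: "u \<in> comb {..<n}" "null_vec G (x - u)" using assms by (auto simp: filt_def)
  have "a0 j u \<in> comb {..<n}"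
    by (rule comb_map[OF linear_a0 u(1)]) (auto intro: grade_comb a0_grade)
  then have "a0 j x \<in> filt n"
    using fs.is_adjoint_null_diff[OF self_adjoint_a0 u(2)] by (rule filtI)
  moreover have "A j x \<in> filt n"
    using A_comb_filt[OF u(1)] fs.is_adjoint_null_diff[OF fs.is_adjoint_sym[OF adjoint_cre] u(2)]
    by (rule filt_null)
  ultimately show ?thesis by (rule fs.subspace_add[OF subspace_filt])
qed

lemma Y_filt: "x \<in> filt n \<Longrightarrow> Y j x \<in> filt (Suc n)"
  unfolding Y_eq by (intro fs.subspace_add[OF subspace_filt] C_filt filt_mono[OF lower_filt]) auto

text \<open>The creator is the leading part of the coordinate. One step changes the difference to
  \<open>Y j (Ymon m - Cmon m)\<close> plus the lower parts of \<open>Y j\<close> at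
  \<open>Cmon m\<close>, both in the next filtration step, and a zero-norm correction.\<close>

lemma Ymon_Cmon: "Ymon m - Cmon m \<in> filt (mdeg m)"
proof (induction m rule: exponent_induct)
  case zero
  show ?case by (simp add: Ymon_0 Cmon_0 fs.subspace_0[OF subspace_filt])
next
  case (add j m)
  have 1: "Ymon (unit_exp j + m) - Y j (Ymon m) \<in> filt (Suc (mdeg m))"
    by (rule null_filt[OF Ymon_add])
  have 2: "Y j (Ymon m - Cmon m) \<in> filt (Suc (mdeg m))" by (rule Y_filt[OF add])
  have 3: "a0 j (Cmon m) + A j (Cmon m) \<in> filt (Suc (mdeg m))"
    by (intro lower_filt grade_filt[OF Cmon_grade]) simp
  have "Ymon (unit_exp j + m) - Y j (Ymon m) + Y j (Ymon m - Cmon m) + (a0 j (Cmon m) + A j (Cmon m))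
      \<in> filt (Suc (mdeg m))"
    by (rule fs.subspace_add[OF subspace_filt fs.subspace_add[OF subspace_filt 1 2] 3])
  also have "Ymon (unit_exp j + m) - Y j (Ymon m) + Y j (Ymon m - Cmon m) + (a0 j (Cmon m) + A j (Cmon m))
      = Ymon (unit_exp j + m) - Cmon (unit_exp j + m)"
    unfolding lin_diff[OF linear_Y] Cmon_add Y_eq[of j "Cmon m"] by (simp add: algebra_simps)
  finally show ?case by (simp add: mdeg_add mdeg_unit_exp plus_1_eq_Suc del: One_nat_def)
qed

lemma poly_vec_filt:
  assumes "p \<in> deg_lt n"
  shows "poly_vec p \<in> filt n"
  using assms unfolding deg_lt_def
proof (induction rule: poly.span_induct_alt)
  case base
  show ?case by (simp add: lin_0[OF linear_poly_vec] fs.subspace_0[OF subspace_filt])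
next
  case (step c p q)
  then obtain m where m: "p = mon m" "mdeg m < n" by blast
  have "Ymon m - Cmon m + Cmon m \<in> filt n"
    using m(2) by (intro fs.subspace_add[OF subspace_filt] filt_mono[OF Ymon_Cmon] grade_filt[OF Cmon_grade]) auto
  then have "poly_vec p \<in> filt n" by (simp add: m(1) poly_vec_mon)
  with step(2) show ?case
    by (simp add: lin_add[OF linear_poly_vec] lin_scale[OF linear_poly_vec] fs.subspace_add[OF subspace_filt]
        fs.subspace_scale[OF subspace_filt])
qed

definition poly_filt :: "nat \<Rightarrow> 'h set" where
  "poly_filt n = {x. \<exists>p\<in>deg_lt n. null_vec G (x - poly_vec p)}"

lemma poly_filt_null: "y \<in> poly_filt n \<Longrightarrow> null_vec G (x - y) \<Longrightarrow> x \<in> poly_filt n"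
  unfolding poly_filt_def using fs.null_diff_trans by blast

lemma poly_filt_mono: "x \<in> poly_filt m \<Longrightarrow> m \<le> n \<Longrightarrow> x \<in> poly_filt n"
  unfolding poly_filt_def using deg_lt_mono by blast

lemma subspace_poly_filt: "fs.subspace (poly_filt n)"
proof (rule fs.subspaceI)
  show "0 \<in> poly_filt n"
    unfolding poly_filt_def using poly.subspace_0[OF subspace_deg_lt]
    by (auto intro!: bexI[of _ 0] simp: lin_0[OF linear_poly_vec] fs.null_zero)
next
  fix x y assume "x \<in> poly_filt n" "y \<in> poly_filt n"
  then obtain p q where pq: "p \<in> deg_lt n" "q \<in> deg_lt n" "null_vec G (x - poly_vec p)" "null_vec G (y - poly_vec q)"
    by (auto simp: poly_filt_def)
  from fs.null_add[OF pq(3,4)] have "null_vec G (x + y - poly_vec (p + q))"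
    by (simp add: lin_add[OF linear_poly_vec] algebra_simps)
  with poly.subspace_add[OF subspace_deg_lt pq(1,2)] show "x + y \<in> poly_filt n" unfolding poly_filt_def by blast
next
  fix c x assume "x \<in> poly_filt n"
  then obtain p where p: "p \<in> deg_lt n" "null_vec G (x - poly_vec p)" by (auto simp: poly_filt_def)
  from fs.null_scale[OF p(2)] have "null_vec G (scl G c x - poly_vec (pscale c p))"
    by (simp add: lin_scale[OF linear_poly_vec] fs.scale_right_diff_distrib)
  with poly.subspace_scale[OF subspace_deg_lt p(1)] show "scl G c x \<in> poly_filt n" unfolding poly_filt_def by blast
qed

text \<open>Creators are recovered as \<open>C j = Y j - (a0 j + A j)\<close>: the coordinate raises
  the polynomial degree by one, and the subtracted terms stay in a step already covered. It is the
  converse of \<open>poly_vec_filt\<close>.\<close>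

lemma filt_subset_poly_filt: "filt n \<subseteq> poly_filt n"
proof -
  have "comb {..<n} \<subseteq> poly_filt n"
  proof (induction n)
    case 0
    show ?case using subspace_poly_filt by (auto simp: comb_def fs.subspace_0)
  next
    case (Suc n)
    \<comment> \<open>Zero-norm shifts extend the induction hypothesis from \<open>comb\<close> to
      \<open>filt n\<close>, where the terms \<open>a0 j y + A j y\<close> lie.\<close>
    have filt_n: "filt n \<subseteq> poly_filt n" using Suc poly_filt_null by (auto simp: filt_def)
    have "x \<in> poly_filt (Suc n)" if x: "x \<in> grade G n" for x
    proof (cases n)
      case 0
      have "vac G \<in> poly_filt (Suc n)"
        unfolding poly_filt_def using mon_deg_lt[of 0 "Suc n"] 0 mdeg_eq_0_iff[of "0 :: 'a \<Rightarrow>\<^sub>0 nat"]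
        by (auto intro!: bexI[of _ 1] simp: poly_vec_1 fs.null_zero)
      then show ?thesis
        using x fs.span_minimal[of "{vac G}" "poly_filt (Suc n)"] subspace_poly_filt 0 grade_0 by auto
    next
      case (Suc i)
      have "C j y \<in> poly_filt (Suc n)" if y: "y \<in> grade G i" for j y
      proof -
        have yn: "y \<in> filt n" using grade_filt[OF y] Suc by simp
        then obtain p where p: "p \<in> deg_lt n" "null_vec G (y - poly_vec p)"
          using filt_n by (auto simp: poly_filt_def)
        have "null_vec G (Y j y - Y j (poly_vec p))" by (rule fs.is_adjoint_null_diff[OF self_adjoint_Y p(2)])
        from fs.null_diff_trans[OF this fs.null_diff_sym[OF poly_vec_pvar]]
        have "Y j y \<in> poly_filt (Suc n)" using pvar_deg_lt[OF p(1)] unfolding poly_filt_def by blast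
        moreover have "a0 j y + A j y \<in> poly_filt (Suc n)"
          using lower_filt[OF yn] filt_n poly_filt_mono[of _ n "Suc n"] by auto
        ultimately have "Y j y - (a0 j y + A j y) \<in> poly_filt (Suc n)"
          by (rule fs.subspace_diff[OF subspace_poly_filt])
        then show ?thesis by (simp add: Y_eq)
      qed
      then have "cre G v y \<in> poly_filt (Suc n)" if "y \<in> grade G i" for v y
        unfolding cre_expand[of v] using that
        by (intro fs.subspace_sum[OF subspace_poly_filt] fs.subspace_scale[OF subspace_poly_filt])
      then have "grade G n \<subseteq> poly_filt (Suc n)"
        unfolding Suc grade_Suc using subspace_poly_filt by (intro fs.span_minimal) (auto simp: Suc)
      then show ?thesis using x by blast
    qed
    moreover have "x \<in> poly_filt (Suc n)" if "x \<in> grade G k" "k < n" for x k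
      using grade_comb[OF that(1), of "{..<n}"] that(2) Suc poly_filt_mono[of _ n "Suc n"] by auto
    ultimately show ?case
      by (intro comb_minimal subspace_poly_filt) (auto simp: less_Suc_eq)
  qed
  then show ?thesis using poly_filt_null by (auto simp: filt_def)
qed

end

section \<open>The isomorphism\<close>

locale fock_state = fock G a0 + gradation \<phi> P
  for G :: "(complex ^ 'a::{finite,linorder}, 'h::ab_group_add) ifs" and a0
    and \<phi> :: "'a cpoly \<Rightarrow> complex" and P +
  assumes expectation: "\<phi> (pmonomial n) = ip G (vac G) (op_monomial (coord G a0) n (vac G))"
begin

lemma ip_poly_vec_state: "ip G (poly_vec p) (poly_vec q) = ip S p q"
  unfolding ip_poly_vec ip_state_space by (rule expectation_poly_vec[OF linear_state expectation, symmetric])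

text \<open>The difference \<open>z\<close> lies in \<open>filt n\<close>, because the leading parts
  cancel, and both of its terms are orthogonal to that step: the first by the isometry, the second
  by its number of particles. Hence \<open>z\<close> is orthogonal to itself.\<close>

lemma poly_vec_P_mon:
  assumes m: "mdeg m = n"
  shows "null_vec G (poly_vec (P n (mon m)) - Cmon m)"
proof -
  define z where "z = poly_vec (P n (mon m)) - Cmon m"
  have "z = (Ymon m - Cmon m) - poly_vec (P_lt n (mon m))"
    by (simp add: z_def P_mon[OF m] lin_diff[OF linear_poly_vec] poly_vec_mon)
  then have "z \<in> filt n"
    using Ymon_Cmon[of m] poly_vec_filt[OF P_lt_deg, of n "mon m"] m
    by (simp add: fs.subspace_diff[OF subspace_filt])
  \<comment> \<open>The representative \<open>u\<close> has fewer than \<open>n\<close> particles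
    exactly, which allows comparison by degree; replacing \<open>z\<close> by \<open>u\<close>
    leaves inner products unchanged.\<close>
  then obtain u where u: "u \<in> comb {..<n}" "null_vec G (z - u)" by (auto simp: filt_def)
  obtain p where p: "p \<in> deg_lt n" "null_vec G (u - poly_vec p)"
    using comb_filt[OF u(1)] filt_subset_poly_filt by (auto simp: poly_filt_def)
  have "ip G (poly_vec (P n (mon m))) u = ip S (mon m) (P n p)"
    using p(2) by (simp add: fs.null_diff_iff_right ip_poly_vec_state ip_P)
  also have "\<dots> = 0" using P_eq_0[OF p(1)] by (simp add: sp.ip_zero_right)
  finally have 1: "ip G (poly_vec (P n (mon m))) u = 0" .
  have "Cmon m \<in> comb {n}" using Cmon_grade[of m] m by (intro grade_comb) auto
  then have "ip G (Cmon m) u = 0" by (intro comb_orth[OF _ u(1)]) auto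
  with 1 have "ip G z u = 0" by (simp add: z_def fs.ip_diff_left)
  moreover have "ip G z z = ip G z u" using u(2) by (simp add: fs.null_diff_iff_right)
  ultimately show ?thesis by (simp add: null_vec_def z_def)
qed

text \<open>The map \<open>Q \<mapsto> Q(Y) \<Phi>\<close> is isometric but graded only up to zero-norm vectors. Since the vectors
  \<open>P n (mon m)\<close> with \<open>mdeg m = n\<close> are linearly independent, there is a linear map sending them
  exactly to the creator monomials: it reads off the coefficients of the leading part of \<open>P n Q\<close>.\<close>

definition lead_vec :: "nat \<Rightarrow> 'a cpoly \<Rightarrow> 'h" where
  "lead_vec n = lin_ext (scl G) (\<lambda>m. if mdeg m = n then Cmon m else 0)"

definition U :: "'a cpoly \<Rightarrow> 'h" where
  "U = graded_map lead_vec"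

lemma linear_lead_vec: "Vector_Spaces.linear pscale (scl G) (lead_vec n)"
  unfolding lead_vec_def by (rule linear_lin_ext) (rule fs.vector_space_axioms)

lemma lead_vec_mon: "lead_vec n (mon m) = (if mdeg m = n then Cmon m else 0)"
  unfolding lead_vec_def by (subst lin_ext_mon) (simp_all add: fs.vector_space_axioms)

lemma lead_vec_deg_lt:
  assumes "p \<in> deg_lt n"
  shows "lead_vec n p = 0"
  using assms unfolding deg_lt_def
  by (induction rule: poly.span_induct_alt)
    (auto simp: lin_0[OF linear_lead_vec] lin_add[OF linear_lead_vec] lin_scale[OF linear_lead_vec] lead_vec_mon)

lemma linear_U: "Vector_Spaces.linear pscale (scl G) U"
  unfolding U_def by (rule linear_graded_map) (rule linear_lead_vec)

lemma U_P_mon: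
  assumes "mdeg m = n"
  shows "U (P n (mon m)) = Cmon m"
proof -
  have "U (P n (mon m)) = lead_vec n (P n (mon m))"
    unfolding U_def by (rule graded_map_homogeneous) (simp_all add: lin_0[OF linear_lead_vec] P_idem)
  also have "\<dots> = lead_vec n (mon m) - lead_vec n (P_lt n (mon m))"
    by (simp add: P_mon[OF assms] lin_diff[OF linear_lead_vec])
  finally show ?thesis using assms by (simp add: lead_vec_mon lead_vec_deg_lt[OF P_lt_deg])
qed

lemma U_real:
  assumes "p \<in> real_polys"
  shows "U p \<in> R"
proof -
  have "lead_vec n q \<in> R" if "q \<in> real_polys" for n q
    unfolding lead_vec_def by (rule lin_ext_closed[OF _ _ _ _ that]) (auto intro: R_0 R_add R_scale Cmon_R)
  then show ?thesis using P_real[OF assms] unfolding U_def graded_map_def by (intro R_sum) blast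
qed

text \<open>So \<open>U\<close> corrects the grading of \<open>poly_vec\<close> by zero-norm vectors
  only, and inherits from it the isometry and the relation with the coordinates.\<close>

lemma U_poly_vec: "null_vec G (U p - poly_vec p)"
  unfolding fs.null_diff_iff_right
proof
  fix z
  have "(ip G z \<circ> U) p = (ip G z \<circ> poly_vec) p"
  proof (rule linear_eq_on_P_mon)
    show "Vector_Spaces.linear pscale (*) (ip G z \<circ> U)" "Vector_Spaces.linear pscale (*) (ip G z \<circ> poly_vec)"
      by (rule Vector_Spaces.linear_compose[OF linear_U fs.linear_ip],
          rule Vector_Spaces.linear_compose[OF linear_poly_vec fs.linear_ip])
    fix n and m :: "'a \<Rightarrow>\<^sub>0 nat" assume "mdeg m = n"
    then show "(ip G z \<circ> U) (P n (mon m)) = (ip G z \<circ> poly_vec) (P n (mon m))"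
      using poly_vec_P_mon[of m n] by (simp add: U_P_mon fs.null_diff_iff_right)
  qed
  then show "ip G z (U p) = ip G z (poly_vec p)" by simp
qed

lemma ip_U: "ip G (U p) (U q) = ip S p q"
proof -
  have "ip G (U p) (U q) = ip G (poly_vec p) (U q)"
    using U_poly_vec[of p] unfolding fs.null_diff_iff_left by simp
  also have "\<dots> = ip G (poly_vec p) (poly_vec q)"
    using U_poly_vec[of q] unfolding fs.null_diff_iff_right by simp
  finally show ?thesis by (simp add: ip_poly_vec_state)
qed

text \<open>Holds exactly: at \<open>P n (mon m)\<close> both sides are the creator monomial with
  exponent \<open>unit_exp j + m\<close>.\<close>

lemma U_qd_plus: "U (qd_plus P j x) = C j (U x)"
proof -
  have "(U \<circ> qd_plus P j) x = (C j \<circ> U) x"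
  proof (rule linear_eq_on_P_mon)
    show "Vector_Spaces.linear pscale (scl G) (U \<circ> qd_plus P j)" "Vector_Spaces.linear pscale (scl G) (C j \<circ> U)"
      by (rule Vector_Spaces.linear_compose[OF linear_qd(1) linear_U],
          rule Vector_Spaces.linear_compose[OF linear_U linear_cre])
    fix n and m :: "'a \<Rightarrow>\<^sub>0 nat" assume m: "mdeg m = n"
    then have "mdeg (unit_exp j + m) = Suc n" by (simp add: mdeg_add mdeg_unit_exp del: One_nat_def)
    from U_P_mon[OF this] show "(U \<circ> qd_plus P j) (P n (mon m)) = (C j \<circ> U) (P n (mon m))"
      by (simp add: qd_plus_P_mon[OF m] U_P_mon[OF m] Cmon_add del: One_nat_def)
  qed
  then show ?thesis by simp
qed

lemma U_cre: "U (cre F v x) = cre G v (U x)"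
  by (simp add: cre_expand[of v] lin_sum[OF linear_U] lin_scale[OF linear_U] U_qd_plus)

lemma U_pvar: "null_vec G (U (pvar j * p) - Y j (U p))"
proof -
  have "null_vec G (U (pvar j * p) - Y j (poly_vec p))"
    using U_poly_vec poly_vec_pvar by (rule fs.null_diff_trans)
  then show ?thesis
    using fs.is_adjoint_null_diff[OF self_adjoint_Y fs.null_diff_sym[OF U_poly_vec]] by (rule fs.null_diff_trans)
qed

lemma U_grade:
  assumes "x \<in> ortho_space P n"
  shows "U x \<in> grade G n"
proof -
  have sub: "fs.subspace (grade G n)" using grade_direct_sum by (simp add: direct_sum_def)
  show ?thesis
    using assms unfolding ortho_space_P_mon
  proof (induction rule: poly.span_induct_alt)
    case base
    show ?case by (simp add: lin_0[OF linear_U] fs.subspace_0[OF sub])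
  next
    case (step c x y)
    then obtain m where "x = P n (mon m)" "mdeg m = n" by blast
    then have "U x \<in> grade G n" using Cmon_grade[of m] by (simp add: U_P_mon)
    with step(2) show ?case
      by (simp add: lin_add[OF linear_U] lin_scale[OF linear_U] fs.subspace_add[OF sub] fs.subspace_scale[OF sub])
  qed
qed

text \<open>The range contains the vacuum and, by exact intertwining, is stable under creators, so
  it contains every degree. Exact surjectivity provides a linear right inverse.\<close>

lemma surj_U: "surj U"
proof -
  have sub: "fs.subspace (range U)" using linear_U by (rule subspace_range)
  have grade: "grade G n \<subseteq> range U" for n
  proof (induction n)
    case 0
    have "U 1 = vac G"
      using U_P_mon[of 0 0] mdeg_eq_0_iff[of "0 :: 'a \<Rightarrow>\<^sub>0 nat"] by (simp add: P_0 state_1 Cmon_0)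
    then have "vac G \<in> range U" by (metis rangeI)
    then show ?case unfolding grade_0 using sub by (intro fs.span_minimal) auto
  next
    case (Suc n)
    show ?case
      unfolding grade_Suc
    proof (intro fs.span_minimal sub subsetI)
      fix y assume "y \<in> (\<Union>v. cre G v ` grade G n)"
      then obtain v x where "y = cre G v (U x)" using Suc by blast
      then show "y \<in> range U" by (simp add: U_cre[symmetric])
    qed
  qed
  have "x \<in> range U" for x
  proof -
    obtain f where f: "\<And>k. f k \<in> grade G k" "x = (\<Sum>k | f k \<noteq> 0. f k)"
      using grade_direct_sum unfolding direct_sum_def by metis
    show ?thesis unfolding f(2) using f(1) grade by (intro fs.subspace_sum[OF sub]) blast
  qed
  then show ?thesis by blast
qed

text \<open>Real vectors are generated by the coordinates, which \<open>U\<close> intertwines with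
  the variables only modulo zero-norm vectors; hence the correction.\<close>

lemma real_vectors_U:
  assumes "y \<in> R"
  shows "\<exists>p\<in>real_polys. null_vec G (y - U p)"
  using assms
proof (induction rule: R_induct)
  case vac
  have "null_vec G (vac G - U 1)" using fs.null_diff_sym[OF U_poly_vec[of 1]] by (simp add: poly_vec_1)
  then show ?case using real_polys_1 by blast
next
  case (add x y)
  then obtain p q where pq: "p \<in> real_polys" "q \<in> real_polys" "null_vec G (x - U p)" "null_vec G (y - U q)" by blast
  from fs.null_add[OF pq(3,4)] have "null_vec G (x + y - U (p + q))"
    by (simp add: lin_add[OF linear_U] algebra_simps)
  then show ?case using real_polys_add[OF pq(1,2)] by blast
next
  case (scale c x)
  then obtain p where p: "p \<in> real_polys" "null_vec G (x - U p)" by blast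
  from fs.null_scale[OF p(2)] have "null_vec G (scl G c x - U (pscale c p))"
    by (simp add: lin_scale[OF linear_U] fs.scale_right_diff_distrib)
  then show ?case using real_polys_pscale[OF scale(1) p(1)] by blast
next
  case (coord j x)
  then obtain p where p: "p \<in> real_polys" "null_vec G (x - U p)" by blast
  have "null_vec G (Y j x - U (pvar j * p))"
    using fs.is_adjoint_null_diff[OF self_adjoint_Y p(2)] fs.null_diff_sym[OF U_pvar]
    by (rule fs.null_diff_trans)
  then show ?case using real_polys_mult[OF real_polys_pvar p(1)] by blast
qed

theorem isomorphism_exists:
  "\<exists>U1 U Us. ifs_isomorphism (*s) (*s) F G U1 U Us \<and>
    U ` real_polys \<subseteq> R \<and> (\<forall>y\<in>R. \<exists>p\<in>real_polys. null_vec G (y - U p)) \<and>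
    (\<forall>j. \<exists>B. is_adjoint S S (Us \<circ> C j \<circ> U) B \<and>
      is_quantum_decomposition \<phi> P j (Us \<circ> C j \<circ> U) (Us \<circ> a0 j \<circ> U) B)"
proof -
  interpret pair: vector_space_pair pscale "scl G"
    using poly.vector_space_axioms fs.vector_space_axioms by (simp add: vector_space_pair_def)
  \<comment> \<open>For an isometry a linear right inverse is an adjoint:
    \<open>ip G (U x) y = ip G (U x) (U (V y)) = ip S x (V y)\<close>.\<close>
  obtain V where linV: "Vector_Spaces.linear (scl G) pscale V" and UV: "U (V y) = y" for y
    using pair.linear_surjective_right_inverse[OF linear_U surj_U] by (auto simp: fun_eq_iff)
  have adjV: "ip G (U x) y = ip S x (V y)" for x y
    using ip_U[of x "V y"] by (simp add: UV)
  have Vadj: "ip S (V y) x = ip G y (U x)" for x y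
    using ip_U[of "V y" x] by (simp add: UV)
  have UV_null: "null_vec S x \<longleftrightarrow> null_vec G (U x)" for x
    by (simp add: null_vec_def ip_U)
  have "ifs_isomorphism (*s) (*s) F G id U V"
    unfolding ifs_isomorphism_def ifs_morphism_def
  proof (intro conjI allI)
    show "Vector_Spaces.linear (*s) (*s) (id :: (complex, 'a) vec \<Rightarrow> (complex, 'a) vec)" by (rule vec.linear_id)
    show "Vector_Spaces.linear (scl F) (scl G) U" using linear_U by simp
    show "U ` grade F n \<subseteq> grade G n" for n using U_grade by auto
    show "ip G (U x) (U y) = ip F x y" for x y by (simp add: ip_U)
    show "is_adjoint F G U V" using linear_U linV by (simp add: is_adjoint_def adjV)
    show "eq_mod_null G (U \<circ> cre F v \<circ> V) (cre G (id v))" for v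
      using U_cre[of v] by (simp add: eq_mod_null_def UV fs.null_zero del: poly_ifs_sel)
    show "\<exists>x. null_vec G (y - U x)" for y
      by (rule exI[of _ "V y"]) (simp add: UV fs.null_zero)
  qed simp
  moreover have "is_adjoint S S (V \<circ> C j \<circ> U) (V \<circ> A j \<circ> U) \<and>
      is_quantum_decomposition \<phi> P j (V \<circ> C j \<circ> U) (V \<circ> a0 j \<circ> U) (V \<circ> A j \<circ> U)" for j
  proof -
    have adj: "is_adjoint S S (V \<circ> C j \<circ> U) (V \<circ> A j \<circ> U)"
      unfolding is_adjoint_def scl_state_space
    proof (intro conjI allI)
      show "Vector_Spaces.linear pscale pscale (V \<circ> C j \<circ> U)" "Vector_Spaces.linear pscale pscale (V \<circ> A j \<circ> U)"
        by (rule Vector_Spaces.linear_compose[OF linear_U Vector_Spaces.linear_compose[OF linear_cre linV]],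
            rule Vector_Spaces.linear_compose[OF linear_U Vector_Spaces.linear_compose[OF linear_ann linV]])
      show "ip S ((V \<circ> C j \<circ> U) x) y = ip S x ((V \<circ> A j \<circ> U) y)" for x y
        using adjoint_cre[of "axis j 1"] by (simp add: Vadj adjV[symmetric] is_adjoint_def)
    qed
    have X: "eq_mod_null S ((*) (pvar j)) (\<lambda>Q. (V \<circ> C j \<circ> U) Q + (V \<circ> a0 j \<circ> U) Q + (V \<circ> A j \<circ> U) Q)"
      using U_pvar by (simp add: eq_mod_null_def UV_null lin_diff[OF linear_U] lin_add[OF linear_U] UV coord_def)
    have plus: "eq_mod_null S (V \<circ> C j \<circ> U) (qd_plus P j)"
      by (simp add: eq_mod_null_def UV_null lin_diff[OF linear_U] UV U_qd_plus fs.null_zero)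
    have minus: "eq_mod_null S (V \<circ> A j \<circ> U) (qd_minus P j)"
      using adj adjoint_qd_plus plus by (rule sp.is_adjoint_unique_mod_null)
    \<comment> \<open>Both triples sum to \<open>pvar j\<close> modulo zero-norm vectors and agree
      in two components, hence also in the third.\<close>
    have "eq_mod_null S (V \<circ> a0 j \<circ> U) (qd_zero P j)"
      unfolding eq_mod_null_def sp.null_diff_iff_left
    proof (intro allI)
      fix x z
      have "ip S (pvar j * x) z = ip S ((V \<circ> C j \<circ> U) x) z + ip S ((V \<circ> a0 j \<circ> U) x) z + ip S ((V \<circ> A j \<circ> U) x) z"
        using X by (simp add: eq_mod_null_def sp.null_diff_iff_left sp.ip_add_left)
      moreover have "ip S (pvar j * x) z = ip S (qd_plus P j x) z + ip S (qd_zero P j x) z + ip S (qd_minus P j x) z"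
        using pvar_decomposition[of j x] by (simp add: sp.null_diff_iff_left sp.ip_add_left)
      moreover have "ip S ((V \<circ> C j \<circ> U) x) z = ip S (qd_plus P j x) z"
        "ip S ((V \<circ> A j \<circ> U) x) z = ip S (qd_minus P j x) z"
        using plus minus unfolding eq_mod_null_def sp.null_diff_iff_left by blast+
      ultimately show "ip S ((V \<circ> a0 j \<circ> U) x) z = ip S (qd_zero P j x) z" by simp
    qed
    with X plus minus adj show ?thesis by (simp add: is_quantum_decomposition_def)
  qed
  ultimately show ?thesis using U_real real_vectors_U by (metis image_subsetI)
qed

end

theorem theorem5p1:
  shows "(\<forall>\<phi> :: 'd::{finite,linorder} cpoly \<Rightarrow> complex. state \<phi> \<longrightarrow>
      (\<exists>P. orthogonal_gradation \<phi> P) \<and>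
      (\<forall>P. orthogonal_gradation \<phi> P \<longrightarrow>
        symmetric_ifs (*s) (poly_ifs \<phi> P) \<and>
        real_structure_cond (poly_ifs \<phi> P) (qd_zero P) real_polys \<and>
        (\<forall>j. is_quantum_decomposition \<phi> P j (qd_plus P j) (qd_zero P j) (qd_minus P j) \<and>
             eq_mod_null (state_space \<phi>) ((*) (pvar j)) (coord (poly_ifs \<phi> P) (qd_zero P) j)) \<and>
        vacuum_cyclic (poly_ifs \<phi> P) (qd_zero P)))
    \<and>
    (\<forall>(F :: (complex ^ 'd::{finite,linorder}, 'h::ab_group_add) ifs) a0.
      symmetric_ifs (*s) F \<longrightarrow>
      real_structure_cond F a0 (real_vectors F a0) \<longrightarrow>
      vacuum_cyclic F a0 \<longrightarrow>
      (\<exists>!\<phi>. state \<phi> \<and>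
         (\<forall>n. \<phi> (pmonomial n) = ip F (vac F) (op_monomial (coord F a0) n (vac F)))) \<and>
      (\<forall>n. ip F (vac F) (op_monomial (coord F a0) n (vac F)) \<in> \<real>) \<and>
      (\<forall>\<phi> P. state \<phi> \<longrightarrow>
         (\<forall>n. \<phi> (pmonomial n) = ip F (vac F) (op_monomial (coord F a0) n (vac F))) \<longrightarrow>
         orthogonal_gradation \<phi> P \<longrightarrow>
         (\<exists>U1 U Us. ifs_isomorphism (*s) (*s) (poly_ifs \<phi> P) F U1 U Us \<and>
            U ` real_polys \<subseteq> real_vectors F a0 \<and>
            (\<forall>y\<in>real_vectors F a0. \<exists>p\<in>real_polys. null_vec F (y - U p)) \<and>
            (\<forall>j. \<exists>C. is_adjoint (state_space \<phi>) (state_space \<phi>) (Us \<circ> cre F (basis_vec j) \<circ> U) C \<and>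
               is_quantum_decomposition \<phi> P j
                 (Us \<circ> cre F (basis_vec j) \<circ> U) (Us \<circ> a0 j \<circ> U) C))))"
proof (rule conjI; intro allI impI)
  fix \<phi> :: "'d cpoly \<Rightarrow> complex"
  assume "state \<phi>"
  then interpret poly_state \<phi> by unfold_locales
  show "(\<exists>P. orthogonal_gradation \<phi> P) \<and>
      (\<forall>P. orthogonal_gradation \<phi> P \<longrightarrow>
        symmetric_ifs (*s) (poly_ifs \<phi> P) \<and>
        real_structure_cond (poly_ifs \<phi> P) (qd_zero P) real_polys \<and>
        (\<forall>j. is_quantum_decomposition \<phi> P j (qd_plus P j) (qd_zero P j) (qd_minus P j) \<and>
             eq_mod_null (state_space \<phi>) ((*) (pvar j)) (coord (poly_ifs \<phi> P) (qd_zero P) j)) \<and>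
        vacuum_cyclic (poly_ifs \<phi> P) (qd_zero P))"
  proof (intro conjI allI impI orthogonal_gradation_exists)
    fix P assume "orthogonal_gradation \<phi> P"
    then interpret gradation \<phi> P by unfold_locales
    show "symmetric_ifs (*s) F" by (rule symmetric_ifs_poly_ifs)
    show "real_structure_cond F (qd_zero P) real_polys" by (rule real_structure_cond_poly_ifs)
    show "vacuum_cyclic F (qd_zero P)" by (rule vacuum_cyclic_poly_ifs)
    fix j
    show "is_quantum_decomposition \<phi> P j (qd_plus P j) (qd_zero P j) (qd_minus P j)"
      by (rule quantum_decomposition)
    show "eq_mod_null S ((*) (pvar j)) (coord F (qd_zero P) j)" by (rule pvar_eq_coord)
  qed
next
  fix F :: "((complex, 'd) vec, 'h) ifs" and a0
  assume sym: "symmetric_ifs (*s) F" and real: "real_structure_cond F a0 (real_vectors F a0)"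
  then interpret fock F a0 by unfold_locales
  show "(\<exists>!\<phi>. state \<phi> \<and>
         (\<forall>n. \<phi> (pmonomial n) = ip F (vac F) (op_monomial (coord F a0) n (vac F)))) \<and>
      (\<forall>n. ip F (vac F) (op_monomial (coord F a0) n (vac F)) \<in> \<real>) \<and>
      (\<forall>\<phi> P. state \<phi> \<longrightarrow>
         (\<forall>n. \<phi> (pmonomial n) = ip F (vac F) (op_monomial (coord F a0) n (vac F))) \<longrightarrow>
         orthogonal_gradation \<phi> P \<longrightarrow>
         (\<exists>U1 U Us. ifs_isomorphism (*s) (*s) (poly_ifs \<phi> P) F U1 U Us \<and>
            U ` real_polys \<subseteq> real_vectors F a0 \<and>
            (\<forall>y\<in>real_vectors F a0. \<exists>p\<in>real_polys. null_vec F (y - U p)) \<and>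
            (\<forall>j. \<exists>C. is_adjoint (state_space \<phi>) (state_space \<phi>) (Us \<circ> cre F (basis_vec j) \<circ> U) C \<and>
               is_quantum_decomposition \<phi> P j
                 (Us \<circ> cre F (basis_vec j) \<circ> U) (Us \<circ> a0 j \<circ> U) C)))"
  proof (intro conjI allI impI state_exists_unique expectation_real)
    fix \<phi> P
    assume "state \<phi>" "\<forall>n. \<phi> (pmonomial n) = ip F (vac F) (op_monomial (coord F a0) n (vac F))"
      "orthogonal_gradation \<phi> P"
    then have "fock_state F a0 \<phi> P"
      using sym real
      by (simp add: fock_state_def fock_def gradation_def gradation_axioms_def poly_state_def fock_state_axioms_def)
    from fock_state.isomorphism_exists[OF this]
    show "\<exists>U1 U Us. ifs_isomorphism (*s) (*s) (poly_ifs \<phi> P) F U1 U Us \<and>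
            U ` real_polys \<subseteq> real_vectors F a0 \<and>
            (\<forall>y\<in>real_vectors F a0. \<exists>p\<in>real_polys. null_vec F (y - U p)) \<and>
            (\<forall>j. \<exists>C. is_adjoint (state_space \<phi>) (state_space \<phi>) (Us \<circ> cre F (basis_vec j) \<circ> U) C \<and>
               is_quantum_decomposition \<phi> P j
                 (Us \<circ> cre F (basis_vec j) \<circ> U) (Us \<circ> a0 j \<circ> U) C)" .
  qed
qed

end
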